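(* Let $\Sigma$ be a smooth oriented surface isometrically embedded in Euclidean space $\mathbb{R}^n$, let $a_1,\ldots,a_n\in C^\infty(\mathbb{R}^n)$ be arbitrary functions, and endow $\Sigma\times\mathbb{R}\subset\mathbb{R}^{n+1}$ with the metric induced by $$ds^2=\sum_{k=1}^n dx_k^2+\Bigl(dt-\sum_{k=1}^n a_k\,dx_k\Bigr)^2,$$ where $(x_1,\ldots,x_n,t)$ are the usual coordinates of $\mathbb{R}^{n+1}$. Then the Killing submersion $\Sigma\times\mathbb{R}\to\Sigma$, $(p,t)\mapsto p$ (with unit vertical Killing vector field $\partial_t$), has bundle curvature $$\tau=\tfrac12\,\mathrm{div}_\Sigma(JT),$$ where $T=(\partial_t)^\top\in\mathfrak{X}(\Sigma)$ is the component of $\partial_t$ tangent to $\Sigma\equiv\Sigma\times\{0\}\subset\mathbb{R}^{n+1}$ with respect to $ds^2$, and $J:\mathfrak{X}(\Sigma)\to\mathfrak{X}(\Sigma)$ is a $\frac{\pi}{2}$-rotation in $T\Sigma$.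
   Context: All manifolds and maps are smooth, and $\mathfrak{X}(\Sigma)$ denotes the vector fields on $\Sigma$. For a submersion $\pi:\mathbb{E}\to M$, a vector $v\in T\mathbb{E}$ is vertical if $v\in\ker(d\pi)$ and horizontal if $v\in\ker(d\pi)^\perp$; the submersion is Riemannian if its differential preserves the length of horizontal vectors. A Killing submersion is a Riemannian submersion $\pi:\mathbb{E}\to M$ from a connected orientable Riemannian $3$-manifold onto a connected orientable Riemannian surface admitting a complete vertical unit Killing vector field $\xi$, the fibers of $\pi$ being the integral curves of $\xi$. Fix an orientation of $\mathbb{E}$, let $\wedge$ be the associated cross product and $\overline\nabla$ the Levi-Civita connection of $\mathbb{E}$. The bundle curvature is the unique function $\tau$ with $\overline\nabla_X\xi=\tau X\wedge\xi$ for all vector fields $X$ on $\mathbb{E}$; it is smooth and constant along the fibers, hence regarded as a function on $M$. In the claim, $\Sigma\times\mathbb{R}$ is oriented as follows: if $\{e_1,e_2\}$ is a positively oriented local frame of $\Sigma$, then $\{E_1,E_2,\partial_t\}$ is positively oriented in $\Sigma\times\mathbb{R}$, where $E_i$ is the horizontal lift of $e_i$. $\mathrm{div}_\Sigma$ is the divergence on $\Sigma$ with its metric induced from $\mathbb{R}^n$.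
   Formalization: T is the field on Σ with ⟨T,e⟩ = ds²(∂_t,e) for all tangent e, ⟨,⟩ being the metric from ℝⁿ. It is not the ds²-orthogonal projection of ∂_t to Σ×{0}, for which the formula fails: Σ=ℝ², a=x dy−y dx has τ=1, but ½div(JT)=1/(1+r²)². *)

theory Defs
  imports "HOL-Analysis.Analysis"
begin

section \<open>Smooth maps and embedded submanifolds of Euclidean spaces\<close>

(* Only used on open sets U of finite-dimensional spaces, where quantifying over all
   directional derivatives is the usual notion of a C^k map. *)
primrec Ck_on :: "nat \<Rightarrow> 'a::real_normed_vector set \<Rightarrow> ('a \<Rightarrow> 'b::real_normed_vector) \<Rightarrow> bool" where
  "Ck_on 0 U f \<longleftrightarrow> continuous_on U f"
| "Ck_on (Suc k) U f \<longleftrightarrow> (\<forall>x\<in>U. f differentiable (at x)) \<and>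
     (\<forall>v. Ck_on k U (\<lambda>x. frechet_derivative f (at x) v))"

definition smooth_on :: "'a::real_normed_vector set \<Rightarrow> ('a \<Rightarrow> 'b::real_normed_vector) \<Rightarrow> bool" where
  "smooth_on U f \<longleftrightarrow> (\<forall>k. Ck_on k U f)"

definition submanifold :: "nat \<Rightarrow> 'a::euclidean_space set \<Rightarrow> bool" where
  "submanifold k M \<longleftrightarrow> (\<forall>p\<in>M. \<exists>U V \<phi> \<psi> (L :: 'a set).
     open U \<and> p \<in> U \<and> open V \<and> homeomorphism U V \<phi> \<psi> \<and> smooth_on U \<phi> \<and> smooth_on V \<psi> \<and>
     subspace L \<and> dim L = k \<and> \<phi> ` (U \<inter> M) = V \<inter> L)"

definition smooth_map :: "'a::euclidean_space set \<Rightarrow> ('a \<Rightarrow> 'b::real_normed_vector) \<Rightarrow> bool" where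
  "smooth_map M f \<longleftrightarrow> (\<forall>p\<in>M. \<exists>U F. open U \<and> p \<in> U \<and> smooth_on U F \<and> (\<forall>q\<in>U \<inter> M. F q = f q))"

definition tangent_space :: "'a::euclidean_space set \<Rightarrow> 'a \<Rightarrow> 'a set" where
  "tangent_space M p = {v. \<exists>\<gamma> \<epsilon>. \<epsilon> > (0::real) \<and> smooth_on {-\<epsilon><..<\<epsilon>} \<gamma> \<and> \<gamma> ` {-\<epsilon><..<\<epsilon>} \<subseteq> M \<and>
     \<gamma> 0 = p \<and> (\<gamma> has_vector_derivative v) (at 0)}"

(* The derivative within M depends only on the values of f on M. It is not determined on all of
   the ambient space, but it is determined on tangent vectors, and it is applied to nothing else. *)
definition differential ::
  "'a::euclidean_space set \<Rightarrow> ('a \<Rightarrow> 'b::real_normed_vector) \<Rightarrow> 'a \<Rightarrow> 'a \<Rightarrow> 'b" where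
  "differential M f p v = frechet_derivative f (at p within M) v"

(* Vector fields are total functions; only their values on M are meaningful. *)
definition vector_fields :: "'a::euclidean_space set \<Rightarrow> ('a \<Rightarrow> 'a) set" where
  "vector_fields M = {X. smooth_map M X \<and> (\<forall>p\<in>M. X p \<in> tangent_space M p)}"

definition lie_bracket ::
  "'a::euclidean_space set \<Rightarrow> ('a \<Rightarrow> 'a) \<Rightarrow> ('a \<Rightarrow> 'a) \<Rightarrow> 'a \<Rightarrow> 'a" where
  "lie_bracket M X Y p = differential M Y p (X p) - differential M X p (Y p)"


section \<open>Riemannian metrics, connections and orientations\<close>

type_synonym 'a metric = "'a \<Rightarrow> 'a \<Rightarrow> 'a \<Rightarrow> real"

definition riemannian_metric :: "'a::euclidean_space set \<Rightarrow> 'a metric \<Rightarrow> bool" where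
  "riemannian_metric M G \<longleftrightarrow>
     (\<forall>p\<in>M. \<forall>u\<in>tangent_space M p. \<forall>v\<in>tangent_space M p. \<forall>w\<in>tangent_space M p. \<forall>c.
        G p (u + v) w = G p u w + G p v w \<and> G p (c *\<^sub>R u) w = c * G p u w \<and> G p u v = G p v u) \<and>
     (\<forall>p\<in>M. \<forall>v\<in>tangent_space M p. v \<noteq> 0 \<longrightarrow> G p v v > 0) \<and>
     (\<forall>X\<in>vector_fields M. \<forall>Y\<in>vector_fields M. smooth_map M (\<lambda>p. G p (X p) (Y p)))"

type_synonym 'a connection = "('a \<Rightarrow> 'a) \<Rightarrow> ('a \<Rightarrow> 'a) \<Rightarrow> 'a \<Rightarrow> 'a"

definition affine_connection :: "'a::euclidean_space set \<Rightarrow> 'a connection \<Rightarrow> bool" where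
  "affine_connection M D \<longleftrightarrow>
     (\<forall>X\<in>vector_fields M. \<forall>Y\<in>vector_fields M. D X Y \<in> vector_fields M) \<and>
     (\<forall>X\<in>vector_fields M. \<forall>Y\<in>vector_fields M. \<forall>Z\<in>vector_fields M. \<forall>p\<in>M.
        D (\<lambda>q. X q + Y q) Z p = D X Z p + D Y Z p \<and>
        D X (\<lambda>q. Y q + Z q) p = D X Y p + D X Z p) \<and>
     (\<forall>X\<in>vector_fields M. \<forall>Y\<in>vector_fields M. \<forall>f. smooth_map M f \<longrightarrow> (\<forall>p\<in>M.
        D (\<lambda>q. f q *\<^sub>R X q) Y p = f p *\<^sub>R D X Y p \<and>
        D X (\<lambda>q. f q *\<^sub>R Y q) p = differential M f p (X p) *\<^sub>R Y p + f p *\<^sub>R D X Y p))"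

definition levi_civita :: "'a::euclidean_space set \<Rightarrow> 'a metric \<Rightarrow> 'a connection \<Rightarrow> bool" where
  "levi_civita M G D \<longleftrightarrow> affine_connection M D \<and>
     (\<forall>X\<in>vector_fields M. \<forall>Y\<in>vector_fields M. \<forall>p\<in>M.
        D X Y p - D Y X p = lie_bracket M X Y p) \<and>
     (\<forall>X\<in>vector_fields M. \<forall>Y\<in>vector_fields M. \<forall>Z\<in>vector_fields M. \<forall>p\<in>M.
        differential M (\<lambda>q. G q (Y q) (Z q)) p (X p) = G p (D X Y p) (Z p) + G p (Y p) (D X Z p))"

definition alternating_form :: "nat \<Rightarrow> 'a::real_vector set \<Rightarrow> ('a list \<Rightarrow> real) \<Rightarrow> bool" where
  "alternating_form k V \<omega> \<longleftrightarrow>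
     (\<forall>us vs x y c. length us + length vs + 1 = k \<and> set us \<union> set vs \<union> {x, y} \<subseteq> V \<longrightarrow>
        \<omega> (us @ (x + y) # vs) = \<omega> (us @ x # vs) + \<omega> (us @ y # vs) \<and>
        \<omega> (us @ (c *\<^sub>R x) # vs) = c * \<omega> (us @ x # vs)) \<and>
     (\<forall>vs. length vs = k \<and> set vs \<subseteq> V \<and> \<not> distinct vs \<longrightarrow> \<omega> vs = 0)"

type_synonym 'a form = "'a \<Rightarrow> 'a list \<Rightarrow> real"

(* An orientation of a k-dimensional M is given by a smooth nowhere vanishing k-form \<omega>:
   the ordered basis vs of the tangent space at p is positively oriented iff \<omega> p vs > 0.
   The form need not be the Riemannian volume form; only its sign is ever used. *)
definition orientation_form :: "nat \<Rightarrow> 'a::euclidean_space set \<Rightarrow> 'a form \<Rightarrow> bool" where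
  "orientation_form k M \<omega> \<longleftrightarrow>
     (\<forall>p\<in>M. alternating_form k (tangent_space M p) (\<omega> p)) \<and>
     (\<forall>p\<in>M. \<forall>vs. length vs = k \<and> set vs \<subseteq> tangent_space M p \<and> distinct vs \<and> independent (set vs)
        \<longrightarrow> \<omega> p vs \<noteq> 0) \<and>
     (\<forall>Xs. length Xs = k \<and> set Xs \<subseteq> vector_fields M \<longrightarrow> smooth_map M (\<lambda>p. \<omega> p (map (\<lambda>X. X p) Xs)))"

definition orthonormal_at :: "'a metric \<Rightarrow> 'a \<Rightarrow> 'a list \<Rightarrow> bool" where
  "orthonormal_at G p vs \<longleftrightarrow>
     (\<forall>i<length vs. \<forall>j<length vs. G p (vs ! i) (vs ! j) = (if i = j then 1 else 0))"

(* The trace of v \<mapsto> D_v X on the tangent space at p of the k-dimensional M, where D is the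
   Levi-Civita connection of M. The fields in Es only need to be orthonormal at the point p. *)
definition divergence ::
  "nat \<Rightarrow> 'a::euclidean_space set \<Rightarrow> 'a metric \<Rightarrow> 'a connection \<Rightarrow> ('a \<Rightarrow> 'a) \<Rightarrow> 'a \<Rightarrow> real" where
  "divergence k M G D X p = (THE d. \<forall>Es. length Es = k \<and> set Es \<subseteq> vector_fields M \<and>
     orthonormal_at G p (map (\<lambda>E. E p) Es) \<longrightarrow> d = (\<Sum>E\<leftarrow>Es. G p (D E X p) (E p)))"

definition cross_product ::
  "'a::euclidean_space set \<Rightarrow> 'a metric \<Rightarrow> 'a form \<Rightarrow> 'a \<Rightarrow> 'a \<Rightarrow> 'a \<Rightarrow> 'a" where
  "cross_product M G \<Omega> p u v = (THE w. w \<in> tangent_space M p \<and> G p w u = 0 \<and> G p w v = 0 \<and>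
     G p w w = G p u u * G p v v - (G p u v)\<^sup>2 \<and> (w \<noteq> 0 \<longrightarrow> \<Omega> p [u, v, w] > 0))"

(* Rotation by +pi/2 in the tangent planes of an oriented Riemannian surface. *)
definition rotation ::
  "'a::euclidean_space set \<Rightarrow> 'a metric \<Rightarrow> 'a form \<Rightarrow> 'a \<Rightarrow> 'a \<Rightarrow> 'a" where
  "rotation M g \<omega> p v = (THE w. w \<in> tangent_space M p \<and> g p w v = 0 \<and> g p w w = g p v v \<and>
     (v \<noteq> 0 \<longrightarrow> \<omega> p [v, w] > 0))"


section \<open>Killing submersions\<close>

definition vertical_space ::
  "'a::euclidean_space set \<Rightarrow> ('a \<Rightarrow> 'b::real_normed_vector) \<Rightarrow> 'a \<Rightarrow> 'a set" where
  "vertical_space E \<pi> q = {v \<in> tangent_space E q. differential E \<pi> q v = 0}"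

definition horizontal_space ::
  "'a::euclidean_space set \<Rightarrow> 'a metric \<Rightarrow> ('a \<Rightarrow> 'b::real_normed_vector) \<Rightarrow> 'a \<Rightarrow> 'a set" where
  "horizontal_space E G \<pi> q =
     {u \<in> tangent_space E q. \<forall>v\<in>vertical_space E \<pi> q. G q u v = 0}"

definition is_horizontal_lift ::
  "'a::euclidean_space set \<Rightarrow> 'a metric \<Rightarrow> ('a \<Rightarrow> 'b::real_normed_vector) \<Rightarrow> 'a \<Rightarrow> 'b \<Rightarrow> 'a \<Rightarrow> bool" where
  "is_horizontal_lift E G \<pi> q e u \<longleftrightarrow> u \<in> horizontal_space E G \<pi> q \<and> differential E \<pi> q u = e"

definition submersion_onto ::
  "'a::euclidean_space set \<Rightarrow> 'b::euclidean_space set \<Rightarrow> ('a \<Rightarrow> 'b) \<Rightarrow> bool" where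
  "submersion_onto E M \<pi> \<longleftrightarrow> smooth_map E \<pi> \<and> \<pi> ` E = M \<and>
     (\<forall>q\<in>E. differential E \<pi> q ` tangent_space E q = tangent_space M (\<pi> q))"

definition riemannian_submersion ::
  "'a::euclidean_space set \<Rightarrow> 'a metric \<Rightarrow> 'b::euclidean_space set \<Rightarrow> 'b metric \<Rightarrow> ('a \<Rightarrow> 'b) \<Rightarrow> bool" where
  "riemannian_submersion E G M g \<pi> \<longleftrightarrow> submersion_onto E M \<pi> \<and>
     (\<forall>q\<in>E. \<forall>u\<in>horizontal_space E G \<pi> q.
        g (\<pi> q) (differential E \<pi> q u) (differential E \<pi> q u) = G q u u)"

definition killing_field :: "'a::euclidean_space set \<Rightarrow> 'a metric \<Rightarrow> ('a \<Rightarrow> 'a) \<Rightarrow> bool" where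
  "killing_field E G \<xi> \<longleftrightarrow> \<xi> \<in> vector_fields E \<and>
     (\<forall>X\<in>vector_fields E. \<forall>Y\<in>vector_fields E. \<forall>q\<in>E.
        differential E (\<lambda>r. G r (X r) (Y r)) q (\<xi> q) =
          G q (lie_bracket E \<xi> X q) (Y q) + G q (X q) (lie_bracket E \<xi> Y q))"

definition integral_curve ::
  "'a::euclidean_space set \<Rightarrow> ('a \<Rightarrow> 'a) \<Rightarrow> (real \<Rightarrow> 'a) \<Rightarrow> bool" where
  "integral_curve E \<xi> \<gamma> \<longleftrightarrow>
     (\<forall>s. \<gamma> s \<in> E \<and> (\<gamma> has_vector_derivative \<xi> (\<gamma> s)) (at s))"

(* The last conjunct contains both the completeness of \<xi> (integral curves are defined on the
   whole real line) and the fact that the fibers are exactly the integral curves. *)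
definition killing_submersion ::
  "'a::euclidean_space set \<Rightarrow> 'a metric \<Rightarrow> 'b::euclidean_space set \<Rightarrow> 'b metric \<Rightarrow>
     ('a \<Rightarrow> 'b) \<Rightarrow> ('a \<Rightarrow> 'a) \<Rightarrow> bool" where
  "killing_submersion E G M g \<pi> \<xi> \<longleftrightarrow>
     submanifold 3 E \<and> connected E \<and> (\<exists>\<Omega>. orientation_form 3 E \<Omega>) \<and> riemannian_metric E G \<and>
     submanifold 2 M \<and> connected M \<and> (\<exists>\<omega>. orientation_form 2 M \<omega>) \<and> riemannian_metric M g \<and>
     riemannian_submersion E G M g \<pi> \<and>
     killing_field E G \<xi> \<and>
     (\<forall>q\<in>E. \<xi> q \<in> vertical_space E \<pi> q \<and> G q (\<xi> q) (\<xi> q) = 1) \<and>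
     (\<forall>q\<in>E. \<exists>\<gamma>. integral_curve E \<xi> \<gamma> \<and> \<gamma> 0 = q \<and> range \<gamma> = {r \<in> E. \<pi> r = \<pi> q})"

(* Here D is the Levi-Civita connection of E, \<Omega> gives the orientation of E, and \<tau> is regarded
   as a function on the base. *)
definition is_bundle_curvature ::
  "'a::euclidean_space set \<Rightarrow> 'a metric \<Rightarrow> 'a form \<Rightarrow> 'a connection \<Rightarrow> ('a \<Rightarrow> 'b) \<Rightarrow> ('a \<Rightarrow> 'a) \<Rightarrow>
     ('b \<Rightarrow> real) \<Rightarrow> bool" where
  "is_bundle_curvature E G \<Omega> D \<pi> \<xi> \<tau> \<longleftrightarrow> (\<forall>X\<in>vector_fields E. \<forall>q\<in>E.
     D X \<xi> q = \<tau> (\<pi> q) *\<^sub>R cross_product E G \<Omega> q (X q) (\<xi> q))"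


section \<open>The metric on the product of a surface and the real line\<close>

definition induced_metric :: "'a::euclidean_space metric" where
  "induced_metric p u v = u \<bullet> v"

definition ds2 :: "('n::finite \<Rightarrow> real^'n \<Rightarrow> real) \<Rightarrow> ((real^'n) \<times> real) metric" where
  "ds2 a = (\<lambda>(x, t) (u, r) (v, s).
     (\<Sum>k\<in>UNIV. u $ k * v $ k) +
     (r - (\<Sum>k\<in>UNIV. a k x * u $ k)) * (s - (\<Sum>k\<in>UNIV. a k x * v $ k)))"

definition ddt :: "(real^'n::finite) \<times> real \<Rightarrow> (real^'n) \<times> real" where
  "ddt q = (0, 1)"

(* The component T of d/dt tangent to S, identified with S x {0}: the vector of the tangent space
   of S with T \<bullet> e = ds^2(d/dt, e) for all tangent e. Equivalently, T is the sum of the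
   ds^2(d/dt, e_i) e_i over a basis (e_i) which is orthonormal for the metric that S inherits
   from R^n.
   Pitfall: ds^2 restricted to S x {0} is not that metric but g + a \<otimes> a. The ds^2-orthogonal
   projection of d/dt to S x {0} is therefore T / (1 + |T|^2). For that projection the formula
   tau = div (J T) / 2 fails, e.g. for a = x dy - y dx on the plane. *)
definition ddt_tangent ::
  "(real^'n::finite) set \<Rightarrow> ('n \<Rightarrow> real^'n \<Rightarrow> real) \<Rightarrow> real^'n \<Rightarrow> real^'n" where
  "ddt_tangent S a p = (THE v. v \<in> tangent_space S p \<and>
     (\<forall>e\<in>tangent_space S p. induced_metric p v e = ds2 a (p, 0) (ddt (p, 0)) (e, 0)))"

end

theory Submission
  imports Defs
begin

text \<open>
  Write \<open>A = (a\<^sub>1, \<dots>, a\<^sub>n)\<close> and let \<open>P\<close> be the orthogonal projection onto the tangent planes of \<open>\<Sigma>\<close>. The one-form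
  dual to the vertical field \<open>\<xi> = \<partial>\<^sub>t\<close> is \<open>\<eta> = dt - A\<close>, where \<open>A\<close> is read as a one-form on \<open>\<Sigma>\<close>, and the metric is
  \<open>g + \<eta>\<^sup>2\<close> with coefficients independent of \<open>t\<close>. So \<open>\<xi>\<close> is a unit Killing field, a vector is
  horizontal iff \<open>\<eta>\<close> vanishes on it, and horizontal vectors have the length of their projection.

  Both sides of the curvature formula compute the exterior derivative \<open>dA\<close> on \<open>\<Sigma>\<close> (\<open>curl\<close> below).

  Upstairs, the covariant derivative of a Killing field is skew, hence \<open>2 \<langle>\<nabla>\<^sub>X \<xi>, Y\<rangle> = d\<eta>(X, Y) = - dA(X, Y)\<close>
  (\<open>killing_field_covariant_derivative\<close> and \<open>bundle_metric_covariant_derivative\<close>). On the other hand,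
  \<open>X \<and> \<xi>\<close> is the horizontal lift of \<open>- J x\<close>, where \<open>x\<close> is the projection of \<open>X\<close> (\<open>cross_product_vertical\<close>). Therefore \<open>\<tau>\<close> is the
  bundle curvature as soon as \<open>dA(x, y) = 2 \<tau> \<langle>J x, y\<rangle>\<close> on \<open>\<Sigma>\<close>.

  Downstairs, \<open>T = - P A\<close>, so \<open>\<langle>J T, e\<rangle> = \<langle>A, J e\<rangle>\<close> for tangent \<open>e\<close>. Extend a positive orthonormal
  basis \<open>e\<^sub>1\<close>, \<open>e\<^sub>2\<close> of one tangent plane to fields that are parallel at the point considered, and differentiate the identity
  for these fields there: the derivatives of the fields contribute nothing to the trace, because the second fundamental form is symmetric. What
  remains is \<open>div (J T) = \<langle>\<partial>\<^sub>1 A, e\<^sub>2\<rangle> - \<langle>\<partial>\<^sub>2 A, e\<^sub>1\<rangle> = dA(e\<^sub>1, e\<^sub>2)\<close> (\<open>trace_differential_eq_curl\<close> and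
  \<open>curl_eq_divergence\<close>).

  Connections, divergence and brackets act on globally defined vector fields. Such fields are obtained by
  projecting functions with values in the ambient space (\<open>orth_proj_vector_field\<close>). The fields \<open>P e\<close> with \<open>e\<close> a constant vector tangent
  at \<open>p\<close> are moreover parallel at \<open>p\<close>, which makes them the extensions that are needed.
\<close>

section \<open>Calculus of smooth maps on open sets\<close>

lemma Ck_on_cong:
  assumes "open U" "\<And>x. x \<in> U \<Longrightarrow> f x = g x"
  shows "Ck_on k U f \<longleftrightarrow> Ck_on k U g"
proof -
  have "Ck_on k U f \<Longrightarrow> Ck_on k U g" if "\<And>x. x \<in> U \<Longrightarrow> f x = g x" for f g :: "'a \<Rightarrow> 'b"
    using that
  proof (induction k arbitrary: f g)
    case 0
    then show ?case by (auto cong: continuous_on_cong)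
  next
    case (Suc k)
    have der: "(g has_derivative D) (at x) \<longleftrightarrow> (f has_derivative D) (at x)" if "x \<in> U" for x D
      using has_derivative_transform_within_open[of f D x UNIV U g]
        has_derivative_transform_within_open[of g D x UNIV U f] \<open>open U\<close> that Suc.prems(2) by auto
    then have "frechet_derivative f (at x) = frechet_derivative g (at x)" if "x \<in> U" for x
      using that by (simp add: frechet_derivative_def)
    moreover have "g differentiable (at x)" if "x \<in> U" for x
      using Suc.prems(1) der that by (auto simp: differentiable_def)
    ultimately show ?case
      using Suc.prems(1) Suc.IH[of "\<lambda>x. frechet_derivative f (at x) v" "\<lambda>x. frechet_derivative g (at x) v" for v]
      by auto
  qed
  from this[of f g] this[of g f] show ?thesis using assms(2) by auto
qed

lemma Ck_on_SucI:
  assumes "open U" "\<And>x. x \<in> U \<Longrightarrow> (f has_derivative f' x) (at x)" "\<And>v. Ck_on k U (\<lambda>x. f' x v)"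
  shows "Ck_on (Suc k) U f"
proof -
  have "frechet_derivative f (at x) = f' x" if "x \<in> U" for x
    using frechet_derivative_at[OF assms(2)[OF that]] by simp
  then have "Ck_on k U (\<lambda>x. frechet_derivative f (at x) v)" for v
    using Ck_on_cong[OF assms(1), of "\<lambda>x. frechet_derivative f (at x) v" "\<lambda>x. f' x v"] assms(3) by auto
  then show ?thesis using assms(2) by (auto simp: differentiable_def)
qed

lemma Ck_on_SucD:
  assumes "Ck_on (Suc k) U f"
  shows "x \<in> U \<Longrightarrow> (f has_derivative frechet_derivative f (at x)) (at x)"
    and "Ck_on k U (\<lambda>x. frechet_derivative f (at x) v)"
  using assms by (auto simp: frechet_derivative_works)

lemma Ck_on_lower: "Ck_on (Suc k) U f \<Longrightarrow> Ck_on k U f"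
proof (induction k arbitrary: f)
  case 0
  then show ?case
    by (auto intro!: continuous_at_imp_continuous_on differentiable_imp_continuous_within)
next
  case (Suc k)
  then show ?case by (metis Ck_on.simps(2))
qed

lemma Ck_on_continuous_on: "Ck_on k U f \<Longrightarrow> continuous_on U f"
  using Ck_on_lower by (induction k) (simp, blast)

lemma Ck_on_subset: "Ck_on k U f \<Longrightarrow> V \<subseteq> U \<Longrightarrow> Ck_on k V f"
  by (induction k arbitrary: f) (auto intro: continuous_on_subset)

lemma Ck_on_const: "Ck_on k U (\<lambda>x. c)"
  by (induction k arbitrary: c) auto

lemma Ck_on_add:
  assumes "open U" "Ck_on k U f" "Ck_on k U g"
  shows "Ck_on k U (\<lambda>x. f x + g x)"
  using assms(2,3)
proof (induction k arbitrary: f g)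
  case 0
  then show ?case by (simp add: continuous_on_add)
next
  case (Suc k)
  note f = Ck_on_SucD[OF Suc.prems(1)] and g = Ck_on_SucD[OF Suc.prems(2)]
  show ?case
    by (rule Ck_on_SucI[OF assms(1) has_derivative_add[OF f(1) g(1)]]) (use Suc.IH f(2) g(2) in auto)
qed

lemma (in bounded_linear) Ck_on_compose:
  assumes "open U" "Ck_on k U g"
  shows "Ck_on k U (\<lambda>x. f (g x))"
  using assms(2)
proof (induction k arbitrary: g)
  case 0
  then show ?case by (auto intro: continuous_on)
next
  case (Suc k)
  note g = Ck_on_SucD[OF Suc.prems(1)]
  show ?case
    by (rule Ck_on_SucI[OF assms(1) has_derivative[OF g(1)]]) (use Suc.IH g(2) in auto)
qed

lemma (in bounded_bilinear) Ck_on_prod: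
  assumes "open U" "Ck_on k U f" "Ck_on k U g"
  shows "Ck_on k U (\<lambda>x. prod (f x) (g x))"
  using assms(2,3)
proof (induction k arbitrary: f g)
  case 0
  then show ?case by (auto intro: continuous_on)
next
  case (Suc k)
  note f = Ck_on_SucD[OF Suc.prems(1)] and g = Ck_on_SucD[OF Suc.prems(2)]
  show ?case
    by (rule Ck_on_SucI[OF assms(1) FDERIV[OF f(1) g(1)]])
      (use f(2) g(2) Suc.prems in \<open>auto intro!: Ck_on_add assms(1) Suc.IH intro: Ck_on_lower simp del: Ck_on.simps\<close>)
qed

lemma Ck_on_sum:
  assumes "open U" "\<And>i. i \<in> I \<Longrightarrow> Ck_on k U (f i)"
  shows "Ck_on k U (\<lambda>x. \<Sum>i\<in>I. f i x)"
  using assms(2)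
  by (induction I rule: infinite_finite_induct) (auto intro: Ck_on_const Ck_on_add assms(1))

text \<open>The induction needs only the chain rule written in coordinates: the derivative of
  \<^term>\<open>f \<circ> g\<close> is a finite sum of products of maps that are one degree less regular.\<close>

lemma Ck_on_compose:
  fixes g :: "'a::real_normed_vector \<Rightarrow> 'b::euclidean_space" and f :: "'b \<Rightarrow> 'c::real_normed_vector"
  assumes "open U" "Ck_on k U g" "Ck_on k V f" "g ` U \<subseteq> V"
  shows "Ck_on k U (\<lambda>x. f (g x))"
  using assms(2,3)
proof (induction k arbitrary: f)
  case 0
  then show ?case using assms(4) continuous_on_compose2 by auto
next
  case (Suc k)
  note f = Ck_on_SucD[OF Suc.prems(2)] and g = Ck_on_SucD[OF Suc.prems(1)]
  have "((\<lambda>x. f (g x)) has_derivative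
      (\<lambda>v. \<Sum>b\<in>Basis. (frechet_derivative g (at x) v \<bullet> b) *\<^sub>R frechet_derivative f (at (g x)) b)) (at x)"
    if "x \<in> U" for x
  proof -
    have fd: "(f has_derivative frechet_derivative f (at (g x))) (at (g x))"
      using f(1) that assms(4) by auto
    interpret linear "frechet_derivative f (at (g x))" by (rule has_derivative_linear[OF fd])
    have "(\<Sum>b\<in>Basis. (w \<bullet> b) *\<^sub>R frechet_derivative f (at (g x)) b) = frechet_derivative f (at (g x)) w" for w
      by (subst euclidean_representation[of w, symmetric]) (simp add: sum scaleR)
    then show ?thesis using has_derivative_compose[OF g(1)[OF that] fd] by simp
  qed
  then show ?case
  proof (rule Ck_on_SucI[OF assms(1)])
    fix v
    show "Ck_on k U (\<lambda>x. \<Sum>b\<in>Basis. (frechet_derivative g (at x) v \<bullet> b) *\<^sub>R frechet_derivative f (at (g x)) b)"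
      by (intro Ck_on_sum assms(1) bounded_bilinear.Ck_on_prod[OF bounded_bilinear_scaleR]
          bounded_linear.Ck_on_compose[OF bounded_linear_inner_left] g(2) Suc.IH f(2) Ck_on_lower[OF Suc.prems(1)])
  qed
qed

text \<open>Real powers cover reciprocals and square roots at once: differentiating a power gives a power again, so
  the induction runs over all exponents simultaneously.\<close>

lemma Ck_on_powr:
  fixes f :: "'a::real_normed_vector \<Rightarrow> real"
  assumes "open U" "Ck_on k U f" "\<And>x. x \<in> U \<Longrightarrow> f x > 0"
  shows "Ck_on k U (\<lambda>x. f x powr c)"
  using assms(2)
proof (induction k arbitrary: c)
  case 0
  then have "continuous_on U f" by simp
  then have "continuous_on U (\<lambda>x. f x powr c)"
    by (rule continuous_on_powr) (use assms(3) in \<open>force intro: continuous_on_const\<close>)+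
  then show ?case by simp
next
  case (Suc k)
  note f = Ck_on_SucD[OF Suc.prems(1)]
  have "((\<lambda>x. f x powr c) has_derivative (\<lambda>v. (c * f x powr (c - 1)) * frechet_derivative f (at x) v)) (at x)"
    if "x \<in> U" for x
  proof -
    have "((\<lambda>z. z powr c) has_field_derivative c * f x powr (c - 1)) (at (f x))"
      using has_real_derivative_powr[OF assms(3)[OF that]] .
    from has_derivative_compose[OF f(1)[OF that] this[unfolded has_field_derivative_def]]
    show ?thesis by simp
  qed
  then show ?case
  proof (rule Ck_on_SucI[OF assms(1)])
    fix v
    show "Ck_on k U (\<lambda>x. (c * f x powr (c - 1)) * frechet_derivative f (at x) v)"
      by (intro bounded_bilinear.Ck_on_prod[OF bounded_bilinear_mult] assms(1) Ck_on_const Suc.IH f(2)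
          Ck_on_lower[OF Suc.prems(1)])
  qed
qed

lemma smooth_on_const: "smooth_on U (\<lambda>x. c)"
  and smooth_on_subset: "smooth_on U f \<Longrightarrow> V \<subseteq> U \<Longrightarrow> smooth_on V f"
  and smooth_on_continuous_on: "smooth_on U f \<Longrightarrow> continuous_on U f"
  and smooth_on_add: "open U \<Longrightarrow> smooth_on U f \<Longrightarrow> smooth_on U g \<Longrightarrow> smooth_on U (\<lambda>x. f x + g x)"
  unfolding smooth_on_def
  by (blast intro: Ck_on_const Ck_on_subset Ck_on_continuous_on Ck_on_add)+

lemma smooth_on_sum:
  "open U \<Longrightarrow> (\<And>i. i \<in> I \<Longrightarrow> smooth_on U (f i)) \<Longrightarrow> smooth_on U (\<lambda>x. \<Sum>i\<in>I. f i x)"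
  unfolding smooth_on_def by (blast intro: Ck_on_sum)

lemma (in bounded_linear) smooth_on: "open U \<Longrightarrow> smooth_on U f"
proof -
  have "Ck_on k U f" if "open U" for k U
  proof (cases k)
    case 0
    then show ?thesis by (simp add: linear_continuous_on bounded_linear_axioms)
  next
    case (Suc n)
    show ?thesis unfolding Suc
      by (rule Ck_on_SucI[OF that]) (auto intro: Ck_on_const has_derivative has_derivative_ident)
  qed
  then show "open U \<Longrightarrow> smooth_on U f" by (simp add: smooth_on_def)
qed

lemma (in bounded_linear) smooth_on_compose:
  "open U \<Longrightarrow> smooth_on U g \<Longrightarrow> smooth_on U (\<lambda>x. f (g x))"
  unfolding smooth_on_def by (blast intro: Ck_on_compose)

lemma (in bounded_bilinear) smooth_on_prod:
  "open U \<Longrightarrow> smooth_on U f \<Longrightarrow> smooth_on U g \<Longrightarrow> smooth_on U (\<lambda>x. prod (f x) (g x))"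
  unfolding smooth_on_def by (blast intro: Ck_on_prod)

lemma smooth_on_compose:
  fixes g :: "'a::real_normed_vector \<Rightarrow> 'b::euclidean_space"
  shows "open U \<Longrightarrow> smooth_on U g \<Longrightarrow> smooth_on V f \<Longrightarrow> g ` U \<subseteq> V \<Longrightarrow> smooth_on U (\<lambda>x. f (g x))"
  unfolding smooth_on_def by (blast intro: Ck_on_compose)

lemma smooth_on_powr:
  "open U \<Longrightarrow> smooth_on U f \<Longrightarrow> (\<And>x. x \<in> U \<Longrightarrow> f x > 0) \<Longrightarrow> smooth_on U (\<lambda>x. (f x :: real) powr c)"
  unfolding smooth_on_def by (blast intro: Ck_on_powr)

lemma smooth_on_Pair:
  assumes "open U" "smooth_on U f" "smooth_on U g"
  shows "smooth_on U (\<lambda>x. (f x, g x))"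
proof -
  have "smooth_on U (\<lambda>x. (f x, 0) + (0, g x))"
    by (intro smooth_on_add bounded_linear.smooth_on_compose[OF bounded_linear_Pair[OF bounded_linear_ident bounded_linear_zero]]
        bounded_linear.smooth_on_compose[OF bounded_linear_Pair[OF bounded_linear_zero bounded_linear_ident]] assms)
  then show ?thesis by simp
qed

lemma smooth_on_has_derivative:
  "smooth_on U f \<Longrightarrow> x \<in> U \<Longrightarrow> (f has_derivative frechet_derivative f (at x)) (at x)"
  using Ck_on_SucD(1) unfolding smooth_on_def by blast

lemma smooth_on_frechet_derivative:
  "smooth_on U f \<Longrightarrow> smooth_on U (\<lambda>x. frechet_derivative f (at x) v)"
  using Ck_on_SucD(2) unfolding smooth_on_def by blast


section \<open>Smooth maps on subsets of a Euclidean space\<close>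

lemma smooth_map_restrict:
  assumes "smooth_map M f" "N \<subseteq> M" shows "smooth_map N f"
  unfolding smooth_map_def
proof
  fix p assume "p \<in> N"
  with assms obtain U F where "open U" "p \<in> U" "smooth_on U F" "\<forall>q\<in>U \<inter> M. F q = f q"
    unfolding smooth_map_def by blast
  with assms(2) show "\<exists>U F. open U \<and> p \<in> U \<and> smooth_on U F \<and> (\<forall>q\<in>U \<inter> N. F q = f q)"
    by (intro exI[of _ U] exI[of _ F]) auto
qed

lemma smooth_map_local:
  assumes "\<And>p. p \<in> M \<Longrightarrow> \<exists>U. open U \<and> p \<in> U \<and> smooth_map (M \<inter> U) f"
  shows "smooth_map M f"
  unfolding smooth_map_def
proof
  fix p assume "p \<in> M"
  then obtain U where U: "open U" "p \<in> U" "smooth_map (M \<inter> U) f" using assms by blast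
  with \<open>p \<in> M\<close> obtain V F where "open V" "p \<in> V" "smooth_on V F" "\<forall>q\<in>V \<inter> (M \<inter> U). F q = f q"
    unfolding smooth_map_def by blast
  with U show "\<exists>U F. open U \<and> p \<in> U \<and> smooth_on U F \<and> (\<forall>q\<in>U \<inter> M. F q = f q)"
    by (intro exI[of _ "U \<inter> V"] exI[of _ F]) (auto intro: smooth_on_subset)
qed

lemma smooth_map_cong:
  assumes "smooth_map M f" "\<And>p. p \<in> M \<Longrightarrow> f p = g p" shows "smooth_map M g"
  using assms unfolding smooth_map_def by (metis IntD2)

lemma smooth_on_imp_smooth_map:
  assumes "open U" "smooth_on U f" "M \<subseteq> U" shows "smooth_map M f"
  using assms unfolding smooth_map_def by blast

lemma smooth_map_const: "smooth_map M (\<lambda>p. c)"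
  by (rule smooth_on_imp_smooth_map[OF open_UNIV smooth_on_const]) simp

lemma smooth_map_binary:
  fixes M :: "'a::euclidean_space set"
  assumes "smooth_map M f" "smooth_map M g"
    and "\<And>(U :: 'a set) F G. open U \<Longrightarrow> smooth_on U F \<Longrightarrow> smooth_on U G \<Longrightarrow> smooth_on U (\<lambda>x. h (F x) (G x))"
  shows "smooth_map M (\<lambda>p. h (f p) (g p))"
  unfolding smooth_map_def
proof
  fix p assume "p \<in> M"
  then obtain U F where F: "open U" "p \<in> U" "smooth_on U F" "\<forall>q\<in>U \<inter> M. F q = f q"
    using assms(1) unfolding smooth_map_def by blast
  obtain V G where G: "open V" "p \<in> V" "smooth_on V G" "\<forall>q\<in>V \<inter> M. G q = g q"
    using assms(2) \<open>p \<in> M\<close> unfolding smooth_map_def by blast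
  have "smooth_on (U \<inter> V) (\<lambda>x. h (F x) (G x))"
    by (rule assms(3)) (use F G in \<open>auto intro: smooth_on_subset\<close>)
  with F G show "\<exists>U H. open U \<and> p \<in> U \<and> smooth_on U H \<and> (\<forall>q\<in>U \<inter> M. H q = h (f q) (g q))"
    by (intro exI[of _ "U \<inter> V"] exI[of _ "\<lambda>x. h (F x) (G x)"]) auto
qed

lemma smooth_map_add: "smooth_map M f \<Longrightarrow> smooth_map M g \<Longrightarrow> smooth_map M (\<lambda>p. f p + g p)"
  by (rule smooth_map_binary) (auto intro: smooth_on_add)

lemma (in bounded_bilinear) smooth_map_prod:
  "smooth_map M f \<Longrightarrow> smooth_map M g \<Longrightarrow> smooth_map M (\<lambda>p. prod (f p) (g p))"
  by (rule smooth_map_binary) (auto intro: smooth_on_prod)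

lemma smooth_map_Pair: "smooth_map M f \<Longrightarrow> smooth_map M g \<Longrightarrow> smooth_map M (\<lambda>p. (f p, g p))"
  by (rule smooth_map_binary) (auto intro: smooth_on_Pair)

lemmas smooth_map_scaleR = bounded_bilinear.smooth_map_prod[OF bounded_bilinear_scaleR]
lemmas smooth_map_inner = bounded_bilinear.smooth_map_prod[OF bounded_bilinear_inner]
lemmas smooth_map_mult = bounded_bilinear.smooth_map_prod[OF bounded_bilinear_mult]

lemma smooth_map_minus: "smooth_map M f \<Longrightarrow> smooth_map M (\<lambda>p. - f p)"
  using smooth_map_scaleR[OF smooth_map_const[of M "-1"], of f] by simp

lemma smooth_map_diff: "smooth_map M f \<Longrightarrow> smooth_map M g \<Longrightarrow> smooth_map M (\<lambda>p. f p - g p)"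
  using smooth_map_add[OF _ smooth_map_minus, of M f g] by simp

lemma smooth_map_powr:
  fixes f :: "'a::euclidean_space \<Rightarrow> real"
  assumes "smooth_map M f" "\<And>p. p \<in> M \<Longrightarrow> f p > 0"
  shows "smooth_map M (\<lambda>p. f p powr c)"
  unfolding smooth_map_def
proof
  fix p assume p: "p \<in> M"
  then obtain U F where F: "open U" "p \<in> U" "smooth_on U F" "\<forall>q\<in>U \<inter> M. F q = f q"
    using assms(1) unfolding smooth_map_def by blast
  let ?V = "U \<inter> F -` {0<..}"
  have "open ?V"
    using continuous_open_preimage[OF smooth_on_continuous_on[OF F(3)] F(1), of "{0<..}"] by simp
  moreover have "smooth_on ?V (\<lambda>x. F x powr c)"
    by (rule smooth_on_powr) (use \<open>open ?V\<close> F in \<open>auto intro: smooth_on_subset\<close>)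
  moreover have "p \<in> ?V" using F p assms(2) by auto
  ultimately show "\<exists>U H. open U \<and> p \<in> U \<and> smooth_on U H \<and> (\<forall>q\<in>U \<inter> M. H q = f q powr c)"
    using F by (intro exI[of _ ?V] exI[of _ "\<lambda>x. F x powr c"]) auto
qed

lemma smooth_map_compose:
  fixes g :: "'a::euclidean_space \<Rightarrow> 'b::euclidean_space"
  assumes "smooth_map M g" "smooth_map N f" "g ` M \<subseteq> N"
  shows "smooth_map M (\<lambda>p. f (g p))"
  unfolding smooth_map_def
proof
  fix p assume p: "p \<in> M"
  then obtain U G where G: "open U" "p \<in> U" "smooth_on U G" "\<forall>q\<in>U \<inter> M. G q = g q"
    using assms(1) unfolding smooth_map_def by blast
  from p assms(3) obtain V F where F: "open V" "g p \<in> V" "smooth_on V F" "\<forall>q\<in>V \<inter> N. F q = f q"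
    using assms(2) unfolding smooth_map_def by blast
  let ?W = "U \<inter> G -` V"
  have "open ?W"
    using continuous_open_preimage[OF smooth_on_continuous_on[OF G(3)] G(1) F(1)] .
  moreover have "smooth_on ?W (\<lambda>x. F (G x))"
    by (rule smooth_on_compose[OF _ _ F(3)]) (use \<open>open ?W\<close> G in \<open>auto intro: smooth_on_subset\<close>)
  moreover have "p \<in> ?W" using F G p by auto
  ultimately show "\<exists>U H. open U \<and> p \<in> U \<and> smooth_on U H \<and> (\<forall>q\<in>U \<inter> M. H q = f (g q))"
    using F G assms(3) by (intro exI[of _ ?W] exI[of _ "\<lambda>x. F (G x)"]) (auto simp: image_subset_iff)
qed

lemma smooth_map_bounded_linear: "bounded_linear f \<Longrightarrow> smooth_map M f"
  by (rule smooth_on_imp_smooth_map[OF open_UNIV]) (auto intro: bounded_linear.smooth_on)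

lemma smooth_map_fst: "smooth_map M fst" and smooth_map_snd: "smooth_map M snd"
  by (auto intro: smooth_map_bounded_linear bounded_linear_fst bounded_linear_snd)

lemma smooth_map_continuous_on:
  assumes "smooth_map M f" shows "continuous_on M f"
  unfolding continuous_on_eq_continuous_within
proof
  fix p assume p: "p \<in> M"
  then obtain U F where F: "open U" "p \<in> U" "smooth_on U F" "\<forall>q\<in>U \<inter> M. F q = f q"
    using assms unfolding smooth_map_def by blast
  have "continuous (at p within M) F"
    using smooth_on_continuous_on[OF F(3)] F(1,2) by (simp add: continuous_at_imp_continuous_at_within continuous_on_eq_continuous_at)
  then have "(F \<longlongrightarrow> f p) (at p within M)"
    using F p by (simp add: continuous_within)
  moreover have "eventually (\<lambda>q. F q = f q) (at p within M)"
    using F by (auto simp: eventually_at_topological)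
  ultimately show "continuous (at p within M) f"
    unfolding continuous_within by (rule Lim_transform_eventually)
qed

lemma smooth_map_has_derivative:
  assumes "smooth_map M f" "p \<in> M"
  shows "(f has_derivative differential M f p) (at p within M)"
proof -
  obtain U F where F: "open U" "p \<in> U" "smooth_on U F" "\<forall>q\<in>U \<inter> M. F q = f q"
    using assms unfolding smooth_map_def by blast
  have "(F has_derivative frechet_derivative F (at p)) (at p within M)"
    using smooth_on_has_derivative[OF F(3,2)] has_derivative_at_withinI by blast
  then have "(f has_derivative frechet_derivative F (at p)) (at p within M)"
    by (rule has_derivative_transform_eventually)
      (use F assms(2) in \<open>auto simp: eventually_at_topological\<close>)
  then have "f differentiable (at p within M)" by (auto simp: differentiable_def)
  then show ?thesis
    unfolding differential_def frechet_derivative_works by (simp add: eta_contract_eq)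
qed

section \<open>Tangent spaces and differentials\<close>

lemma tangent_spaceI:
  assumes "\<epsilon> > (0::real)" "smooth_on {-\<epsilon><..<\<epsilon>} \<gamma>" "\<And>s. s \<in> {-\<epsilon><..<\<epsilon>} \<Longrightarrow> \<gamma> s \<in> M"
    "\<gamma> 0 = p" "(\<gamma> has_vector_derivative v) (at 0)"
  shows "v \<in> tangent_space M p"
  unfolding tangent_space_def
  by (rule CollectI, rule exI[of _ \<gamma>], rule exI[of _ \<epsilon>]) (use assms in auto)

lemma tangent_spaceE:
  assumes "v \<in> tangent_space M p"
  obtains \<gamma> \<epsilon> where "\<epsilon> > (0::real)" "smooth_on {-\<epsilon><..<\<epsilon>} \<gamma>" "\<gamma> ` {-\<epsilon><..<\<epsilon>} \<subseteq> M"
    "\<gamma> 0 = p" "(\<gamma> has_vector_derivative v) (at 0)"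
  using assms unfolding tangent_space_def mem_Collect_eq by (elim exE conjE)

text \<open>A derivative within \<^term>\<open>M\<close> is not unique as a linear map on the ambient space. Its value on a tangent vector is,
  since it is the derivative of \<^term>\<open>f\<close> along a curve in \<^term>\<open>M\<close>.\<close>

lemma differential_eq:
  assumes "(f has_derivative f') (at p within M)" "v \<in> tangent_space M p"
  shows "differential M f p v = f' v"
proof -
  obtain \<gamma> \<epsilon> where \<gamma>: "\<epsilon> > (0::real)" "smooth_on {-\<epsilon><..<\<epsilon>} \<gamma>" "\<gamma> ` {-\<epsilon><..<\<epsilon>} \<subseteq> M" "\<gamma> 0 = p" "(\<gamma> has_vector_derivative v) (at 0)"
    using assms(2) by (rule tangent_spaceE)
  let ?I = "{-\<epsilon><..<\<epsilon>}"
  have I: "at 0 within ?I = at 0" by (rule at_within_open) (use \<gamma>(1) in auto)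
  have c: "((\<lambda>s. f (\<gamma> s)) has_derivative (\<lambda>s. D (s *\<^sub>R v))) (at 0)"
    if "(f has_derivative D) (at p within M)" for D
  proof -
    have "(\<gamma> has_derivative (\<lambda>s. s *\<^sub>R v)) (at 0 within ?I)"
      using \<gamma>(5) I by (simp add: has_vector_derivative_def)
    moreover have "(f has_derivative D) (at (\<gamma> 0) within \<gamma> ` ?I)"
      using that \<gamma>(3,4) has_derivative_subset by blast
    ultimately show ?thesis using has_derivative_in_compose[of \<gamma> _ 0 ?I f D] I by simp
  qed
  have "(f has_derivative differential M f p) (at p within M)"
    using assms(1) frechet_derivative_works[of f "at p within M"]
    unfolding differential_def differentiable_def by (auto simp: eta_contract_eq)
  from has_derivative_unique[OF c[OF this] c[OF assms(1)]]
  have "differential M f p (1 *\<^sub>R v) = f' (1 *\<^sub>R v)" by metis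
  then show ?thesis by simp
qed

lemma differential_const: "v \<in> tangent_space M p \<Longrightarrow> differential M (\<lambda>q. c) p v = 0"
  by (rule differential_eq[where f' = "\<lambda>v. 0"]) auto

text \<open>The product of the surface with the line is handled through its curves, whose two components
  can be prescribed independently.\<close>

lemma tangent_space_Times_UNIV:
  fixes S :: "'a::euclidean_space set" and t :: real
  shows "tangent_space (S \<times> UNIV) (p, t) = tangent_space S p \<times> UNIV"
proof (intro equalityI subsetI)
  fix v assume "v \<in> tangent_space (S \<times> UNIV) (p, t)"
  then obtain \<gamma> \<epsilon> where \<gamma>: "\<epsilon> > (0::real)" "smooth_on {-\<epsilon><..<\<epsilon>} \<gamma>" "\<gamma> ` {-\<epsilon><..<\<epsilon>} \<subseteq> S \<times> UNIV"
      "\<gamma> 0 = (p, t)" "(\<gamma> has_vector_derivative v) (at 0)"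
    by (rule tangent_spaceE)
  have "smooth_on {-\<epsilon><..<\<epsilon>} (\<lambda>s. fst (\<gamma> s))"
    by (rule bounded_linear.smooth_on_compose[OF bounded_linear_fst _ \<gamma>(2)]) simp
  moreover have "((\<lambda>s. fst (\<gamma> s)) has_vector_derivative fst v) (at 0)"
    by (rule bounded_linear.has_vector_derivative[OF bounded_linear_fst \<gamma>(5)])
  moreover have "(\<lambda>s. fst (\<gamma> s)) ` {-\<epsilon><..<\<epsilon>} \<subseteq> S"
    using \<gamma>(3) by fastforce
  ultimately have "fst v \<in> tangent_space S p"
    by (intro tangent_spaceI[OF \<gamma>(1), of "\<lambda>s. fst (\<gamma> s)"]) (use \<gamma>(4) in auto)
  then show "v \<in> tangent_space S p \<times> UNIV" by (simp add: mem_Times_iff)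
next
  fix v assume "v \<in> tangent_space S p \<times> (UNIV :: real set)"
  then obtain u r where v: "v = (u, r)" and u: "u \<in> tangent_space S p" by auto
  obtain \<gamma> \<epsilon> where \<gamma>: "\<epsilon> > (0::real)" "smooth_on {-\<epsilon><..<\<epsilon>} \<gamma>" "\<gamma> ` {-\<epsilon><..<\<epsilon>} \<subseteq> S"
      "\<gamma> 0 = p" "(\<gamma> has_vector_derivative u) (at 0)"
    using u by (rule tangent_spaceE)
  have "smooth_on {-\<epsilon><..<\<epsilon>} (\<lambda>s. t + s *\<^sub>R r)"
    by (intro smooth_on_add smooth_on_const bounded_linear.smooth_on[OF bounded_linear_scaleR_left]) auto
  then have "smooth_on {-\<epsilon><..<\<epsilon>} (\<lambda>s. (\<gamma> s, t + s *\<^sub>R r))"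
    by (intro smooth_on_Pair \<gamma>) auto
  moreover have "((\<lambda>s. (\<gamma> s, t + s *\<^sub>R r)) has_vector_derivative (u, r)) (at 0)"
  proof -
    have "((\<lambda>s. t + s *\<^sub>R r) has_derivative (\<lambda>s. s *\<^sub>R r)) (at 0)"
      by (auto intro!: derivative_eq_intros)
    from has_derivative_Pair[OF \<gamma>(5)[unfolded has_vector_derivative_def] this]
    show ?thesis unfolding has_vector_derivative_def by simp
  qed
  ultimately show "v \<in> tangent_space (S \<times> UNIV) (p, t)"
    unfolding v by (intro tangent_spaceI[OF \<gamma>(1), of "\<lambda>s. (\<gamma> s, t + s *\<^sub>R r)"]) (use \<gamma>(3,4) in auto)
qed

lemma has_vector_derivative_in_subspace:
  fixes h :: "real \<Rightarrow> 'a::euclidean_space"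
  assumes "subspace L" "(h has_vector_derivative w) (at 0)" "eventually (\<lambda>s. h s \<in> L) (nhds 0)"
  shows "w \<in> L"
proof (rule Lim_in_closed_set[of L])
  show "((\<lambda>s. (h (0 + s) - h 0) /\<^sub>R s) \<longlongrightarrow> w) (at 0)"
  proof -
    have "((\<lambda>s. norm ((h (0 + s) - h 0 - s *\<^sub>R w) /\<^sub>R norm s)) \<longlongrightarrow> 0) (at 0)"
      using assms(2) unfolding has_vector_derivative_def has_derivative_at
      by (simp add: divide_inverse mult.commute)
    then have "((\<lambda>s. norm ((h (0 + s) - h 0) /\<^sub>R s - w)) \<longlongrightarrow> 0) (at 0)"
    proof (rule Lim_transform_eventually)
      have "norm ((h s - h 0 - s *\<^sub>R w) /\<^sub>R norm s) = norm ((h s - h 0) /\<^sub>R s - w)" if "s \<noteq> 0" for s :: real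
      proof -
        have "(h s - h 0) /\<^sub>R s - w = (h s - h 0 - s *\<^sub>R w) /\<^sub>R s"
          using that by (simp add: scaleR_diff_right)
        then show ?thesis by simp
      qed
      then show "eventually (\<lambda>s. norm ((h (0 + s) - h 0 - s *\<^sub>R w) /\<^sub>R norm s)
          = norm ((h (0 + s) - h 0) /\<^sub>R s - w)) (at 0)"
        by (auto simp: eventually_at_filter)
    qed
    then show ?thesis by (simp add: tendsto_norm_zero_iff LIM_zero_iff)
  qed
  have "h 0 \<in> L" using assms(3) eventually_nhds_x_imp_x by blast
  then have "eventually (\<lambda>s. (h s - h 0) /\<^sub>R s \<in> L) (nhds 0)"
    by (intro eventually_mono[OF assms(3)] subspace_scale subspace_diff assms(1))
  then show "eventually (\<lambda>s. (h (0 + s) - h 0) /\<^sub>R s \<in> L) (at 0)"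
    by (auto simp: eventually_at_filter elim: eventually_mono)
qed (use assms(1) closed_subspace in auto)

text \<open>In a chart the submanifold is a piece of the subspace \<^term>\<open>L\<close>: curves in it are the images of curves
  in \<^term>\<open>L\<close>, and straight segments already realize every tangent direction.\<close>

lemma tangent_space_chart:
  fixes M :: "'a::euclidean_space set" and \<phi> \<psi> :: "'a \<Rightarrow> 'a"
  assumes "open U" "open V" "homeomorphism U V \<phi> \<psi>" "smooth_on U \<phi>" "smooth_on V \<psi>"
    and L: "subspace L" "\<phi> ` (U \<inter> M) = V \<inter> L" and p: "p \<in> U \<inter> M"
  shows "tangent_space M p = frechet_derivative \<psi> (at (\<phi> p)) ` L"
    and "inj (frechet_derivative \<psi> (at (\<phi> p)))"
proof -
  let ?D = "frechet_derivative \<psi> (at (\<phi> p))" and ?C = "frechet_derivative \<phi> (at p)"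
  have \<phi>p: "\<phi> p \<in> V" "\<phi> p \<in> L" using L(2) p by blast+
  have inv: "\<And>x. x \<in> U \<Longrightarrow> \<psi> (\<phi> x) = x" "\<And>y. y \<in> V \<Longrightarrow> \<phi> (\<psi> y) = y"
    using assms(3) by (auto simp: homeomorphism_def)
  have D: "(\<psi> has_derivative ?D) (at (\<phi> p))" using smooth_on_has_derivative[OF assms(5) \<phi>p(1)] .
  have C: "(\<phi> has_derivative ?C) (at p)" using smooth_on_has_derivative[OF assms(4)] p by blast
  have "((\<lambda>y. \<phi> (\<psi> y)) has_derivative (\<lambda>w. ?C (?D w))) (at (\<phi> p))"
    by (rule has_derivative_compose[OF D]) (use C inv p in auto)
  then have "((\<lambda>y. y) has_derivative (\<lambda>w. ?C (?D w))) (at (\<phi> p))"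
    by (rule has_derivative_transform_within_open[OF _ assms(2) \<phi>p(1)]) (use inv in auto)
  then have CD: "?C (?D w) = w" for w
    using has_derivative_unique[OF _ has_derivative_ident] by metis
  then show "inj ?D" by (metis injI)
  show "tangent_space M p = ?D ` L"
  proof (intro equalityI subsetI)
    fix v assume "v \<in> ?D ` L"
    then obtain l where l: "l \<in> L" "v = ?D l" by blast
    let ?h = "\<lambda>s::real. \<phi> p + s *\<^sub>R l"
    have "open (?h -` V)" by (intro open_vimage assms(2) continuous_intros)
    then obtain \<epsilon> where \<epsilon>: "\<epsilon> > 0" "ball 0 \<epsilon> \<subseteq> ?h -` V"
      using \<phi>p(1) open_contains_ball[of "?h -` V"] by force
    have ball: "ball (0::real) \<epsilon> = {-\<epsilon><..<\<epsilon>}" by (simp add: ball_eq_greaterThanLessThan)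
    have sh: "smooth_on {-\<epsilon><..<\<epsilon>} ?h"
      by (intro smooth_on_add smooth_on_const bounded_linear.smooth_on[OF bounded_linear_scaleR_left]) auto
    have "smooth_on {-\<epsilon><..<\<epsilon>} (\<lambda>s. \<psi> (?h s))"
      by (rule smooth_on_compose[OF _ sh assms(5)]) (use \<epsilon> ball in auto)
    moreover have "\<psi> (?h s) \<in> M" if "s \<in> {-\<epsilon><..<\<epsilon>}" for s
    proof -
      have "?h s \<in> V \<inter> L"
        using that \<epsilon>(2) ball \<phi>p(2) l(1) L(1) by (auto intro: subspace_add subspace_scale)
      then obtain x where "x \<in> U \<inter> M" "?h s = \<phi> x" using L(2) by blast
      then show ?thesis using inv by auto
    qed
    moreover have "((\<lambda>s. \<psi> (?h s)) has_vector_derivative v) (at 0)"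
    proof -
      have "(?h has_derivative (\<lambda>s. s *\<^sub>R l)) (at 0)"
        by (auto intro!: derivative_eq_intros)
      moreover have "(\<psi> has_derivative ?D) (at (?h 0))" using D by simp
      ultimately have "((\<lambda>s. \<psi> (?h s)) has_derivative (\<lambda>s. ?D (s *\<^sub>R l))) (at 0)"
        by (rule has_derivative_compose)
      then show ?thesis
        unfolding has_vector_derivative_def l(2) by (simp add: linear_scale[OF has_derivative_linear[OF D]])
    qed
    ultimately show "v \<in> tangent_space M p"
      by (intro tangent_spaceI[OF \<epsilon>(1), of "\<lambda>s. \<psi> (?h s)"]) (use inv p in auto)
  next
    fix v assume "v \<in> tangent_space M p"
    then obtain \<gamma> \<epsilon> where \<gamma>: "\<epsilon> > (0::real)" "smooth_on {-\<epsilon><..<\<epsilon>} \<gamma>" "\<gamma> ` {-\<epsilon><..<\<epsilon>} \<subseteq> M"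
        "\<gamma> 0 = p" "(\<gamma> has_vector_derivative v) (at 0)"
      by (rule tangent_spaceE)
    have d: "(\<gamma> has_derivative (\<lambda>s. s *\<^sub>R v)) (at 0)" using \<gamma>(5) by (simp add: has_vector_derivative_def)
    have "((\<lambda>s. \<phi> (\<gamma> s)) has_derivative (\<lambda>s. ?C (s *\<^sub>R v))) (at 0)"
      by (rule has_derivative_compose[OF d]) (use C \<gamma>(4) in auto)
    then have hv: "((\<lambda>s. \<phi> (\<gamma> s)) has_vector_derivative ?C v) (at 0)"
      by (simp add: has_vector_derivative_def linear_scale[OF has_derivative_linear[OF C]])
    have "isCont \<gamma> 0" using d has_derivative_continuous by blast
    then have "eventually (\<lambda>s. \<gamma> s \<in> U) (nhds 0)"
      using p \<gamma>(4) assms(1) by (auto simp: isCont_def tendsto_def eventually_at_filter elim: eventually_mono)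
    moreover have "eventually (\<lambda>s. s \<in> {-\<epsilon><..<\<epsilon>}) (nhds 0)"
      by (rule eventually_nhds_in_open) (use \<gamma>(1) in auto)
    ultimately have UM: "eventually (\<lambda>s. \<gamma> s \<in> U \<inter> M) (nhds 0)"
      by eventually_elim (use \<gamma>(3) in auto)
    then have "eventually (\<lambda>s. \<phi> (\<gamma> s) \<in> L) (nhds 0)"
      by (rule eventually_mono) (use L(2) in auto)
    with L(1) hv have CL: "?C v \<in> L" by (rule has_vector_derivative_in_subspace)
    have "((\<lambda>s. \<psi> (\<phi> (\<gamma> s))) has_derivative (\<lambda>s. ?D (s *\<^sub>R ?C v))) (at 0)"
      by (rule has_derivative_compose[OF hv[unfolded has_vector_derivative_def]]) (use D \<gamma>(4) in auto)
    then have "(\<gamma> has_derivative (\<lambda>s. ?D (s *\<^sub>R ?C v))) (at 0)"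
      by (rule has_derivative_transform_eventually)
        (use UM inv \<gamma>(4) p in \<open>auto simp: eventually_at_filter elim!: eventually_mono\<close>)
    from has_derivative_unique[OF this d] have "?D (1 *\<^sub>R ?C v) = 1 *\<^sub>R v" by metis
    then have "v = ?D (?C v)" by simp
    with CL show "v \<in> ?D ` L" by blast
  qed
qed

lemma subspace_dim_tangent_space:
  assumes "submanifold k M" "p \<in> M"
  shows "subspace (tangent_space M p)" "dim (tangent_space M p) = k"
proof -
  obtain U V \<phi> \<psi> and L :: "'a set" where c: "open U" "p \<in> U" "open V" "homeomorphism U V \<phi> \<psi>" "smooth_on U \<phi>"
      "smooth_on V \<psi>" "subspace L" "dim L = k" "\<phi> ` (U \<inter> M) = V \<inter> L"
    using assms unfolding submanifold_def by meson
  have "p \<in> U \<inter> M" using c assms by auto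
  note T = tangent_space_chart[OF c(1,3,4,5,6,7,9) this]
  have "\<phi> p \<in> V" using c(9) \<open>p \<in> U \<inter> M\<close> by blast
  then have lin: "linear (frechet_derivative \<psi> (at (\<phi> p)))"
    using has_derivative_linear[OF smooth_on_has_derivative[OF c(6)]] by blast
  show "subspace (tangent_space M p)"
    unfolding T(1) by (rule linear_subspace_image[OF lin c(7)])
  show "dim (tangent_space M p) = k"
    unfolding T(1) c(8)[symmetric] by (rule dim_image_eq[OF lin]) (use T(2) in \<open>auto intro: inj_on_subset\<close>)
qed

lemma dim_2_orthonormal_basis:
  fixes T :: "'a::euclidean_space set"
  assumes "subspace T" "dim T = 2"
  obtains b c where "b \<in> T" "c \<in> T" "b \<bullet> b = 1" "c \<bullet> c = 1" "b \<bullet> c = 0"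
    "\<And>v. v \<in> T \<Longrightarrow> v = (b \<bullet> v) *\<^sub>R b + (c \<bullet> v) *\<^sub>R c"
proof -
  obtain B where B: "B \<subseteq> T" "pairwise orthogonal B" "\<And>x. x \<in> B \<Longrightarrow> norm x = 1" "independent B"
      "card B = dim T" "span B = T"
    using orthonormal_basis_subspace[OF assms(1)] by metis
  obtain b c where bc: "B = {b, c}" "b \<noteq> c" using B(5) assms(2) by (auto simp: card_2_iff)
  have o: "b \<bullet> b = 1" "c \<bullet> c = 1" "b \<bullet> c = 0"
    using B(2,3) bc by (auto simp: pairwise_def orthogonal_def norm_eq_1)
  have "v = (b \<bullet> v) *\<^sub>R b + (c \<bullet> v) *\<^sub>R c" if "v \<in> T" for v
  proof -
    have "v \<in> span (insert b {c})" using that B(6) bc by simp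
    then obtain x where "v - x *\<^sub>R b \<in> span {c}" by (auto simp: span_breakdown_eq)
    then obtain y where "v - x *\<^sub>R b = y *\<^sub>R c" by (auto simp: span_singleton)
    then have v: "v = x *\<^sub>R b + y *\<^sub>R c" by (simp add: algebra_simps)
    have "b \<bullet> v = x" "c \<bullet> v = y"
      unfolding v using o by (simp_all add: inner_add_right inner_commute[of c b])
    with v show ?thesis by simp
  qed
  with that o B(1) bc show thesis by blast
qed

lemma smooth_tangent_frame:
  assumes "submanifold 2 S" "p \<in> S"
  obtains U f g where "open U" "p \<in> U" "smooth_map (S \<inter> U) f" "smooth_map (S \<inter> U) g"
    "\<And>q. q \<in> S \<inter> U \<Longrightarrow> f q \<in> tangent_space S q \<and> g q \<in> tangent_space S q"
    "\<And>q v. q \<in> S \<inter> U \<Longrightarrow> v \<in> tangent_space S q \<Longrightarrow> \<exists>x y. v = x *\<^sub>R f q + y *\<^sub>R g q"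
    "\<And>q x y. q \<in> S \<inter> U \<Longrightarrow> x *\<^sub>R f q + y *\<^sub>R g q = 0 \<Longrightarrow> x = 0 \<and> y = 0"
proof -
  obtain U V \<phi> \<psi> and L :: "'a set" where c: "open U" "p \<in> U" "open V" "homeomorphism U V \<phi> \<psi>" "smooth_on U \<phi>"
      "smooth_on V \<psi>" "subspace L" "dim L = 2" "\<phi> ` (U \<inter> S) = V \<inter> L"
    using assms unfolding submanifold_def by meson
  obtain b c' where bc: "b \<in> L" "c' \<in> L" "b \<bullet> b = 1" "c' \<bullet> c' = 1" "b \<bullet> c' = 0"
    "\<And>v. v \<in> L \<Longrightarrow> v = (b \<bullet> v) *\<^sub>R b + (c' \<bullet> v) *\<^sub>R c'"
    using dim_2_orthonormal_basis[OF c(7,8)] by metis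
  let ?D = "\<lambda>q. frechet_derivative \<psi> (at (\<phi> q))"
  have \<phi>V: "\<phi> q \<in> V" if "q \<in> U" for q using c(4) that by (auto simp: homeomorphism_def)
  have sm: "smooth_map (S \<inter> U) (\<lambda>q. ?D q l)" for l
  proof (rule smooth_on_imp_smooth_map[OF c(1)])
    show "smooth_on U (\<lambda>q. ?D q l)"
      by (rule smooth_on_compose[OF c(1,5) smooth_on_frechet_derivative[OF c(6)]]) (use \<phi>V in auto)
  qed auto
  have T: "tangent_space S q = ?D q ` L" "inj (?D q)" if "q \<in> S \<inter> U" for q
    using tangent_space_chart[OF c(1,3,4,5,6,7,9), of q] that by auto
  have lin: "linear (?D q)" if "q \<in> S \<inter> U" for q
    using has_derivative_linear[OF smooth_on_has_derivative[OF c(6) \<phi>V]] that by blast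
  show thesis
  proof (rule that[OF c(1,2) sm[of b] sm[of c']])
    show "?D q b \<in> tangent_space S q \<and> ?D q c' \<in> tangent_space S q" if "q \<in> S \<inter> U" for q
      using T(1)[OF that] bc(1,2) by auto
    show "\<exists>x y. v = x *\<^sub>R ?D q b + y *\<^sub>R ?D q c'" if q: "q \<in> S \<inter> U" and v: "v \<in> tangent_space S q" for q v
    proof -
      obtain l where l: "l \<in> L" "v = ?D q l" using T(1)[OF q] v by blast
      have "v = (b \<bullet> l) *\<^sub>R ?D q b + (c' \<bullet> l) *\<^sub>R ?D q c'"
        unfolding l(2) by (subst bc(6)[OF l(1)]) (simp add: linear_add[OF lin[OF q]] linear_scale[OF lin[OF q]])
      then show ?thesis by blast
    qed
    show "x = 0 \<and> y = 0" if q: "q \<in> S \<inter> U" and 0: "x *\<^sub>R ?D q b + y *\<^sub>R ?D q c' = 0" for q x y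
    proof -
      have "?D q (x *\<^sub>R b + y *\<^sub>R c') = ?D q 0"
        using 0 by (simp add: linear_add[OF lin[OF q]] linear_scale[OF lin[OF q]] linear_0[OF lin[OF q]])
      then have *: "x *\<^sub>R b + y *\<^sub>R c' = 0" using T(2)[OF q] by (rule injD[rotated])
      have "b \<bullet> (x *\<^sub>R b + y *\<^sub>R c') = x" "c' \<bullet> (x *\<^sub>R b + y *\<^sub>R c') = y"
        using bc by (simp_all add: inner_add_right inner_commute[of c' b])
      then show ?thesis unfolding * by simp
    qed
  qed
qed

lemma submanifold_Times_UNIV:
  assumes "submanifold k S"
  shows "submanifold (Suc k) (S \<times> (UNIV :: real set))"
  unfolding submanifold_def
proof
  fix q assume q: "q \<in> S \<times> (UNIV :: real set)"
  then have "fst q \<in> S" by auto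
  then obtain U V \<phi> \<psi> and L :: "'a set" where c: "open U" "fst q \<in> U" "open V" "homeomorphism U V \<phi> \<psi>"
      "smooth_on U \<phi>" "smooth_on V \<psi>" "subspace L" "dim L = k" "\<phi> ` (U \<inter> S) = V \<inter> L"
    using assms unfolding submanifold_def by meson
  let ?f = "\<lambda>x :: 'a \<times> real. (\<phi> (fst x), snd x)" and ?g = "\<lambda>x :: 'a \<times> real. (\<psi> (fst x), snd x)"
  have sm: "smooth_on (A \<times> UNIV) (\<lambda>x :: 'a \<times> real. (h (fst x), snd x))"
    if "open A" "smooth_on A h" for A and h :: "'a \<Rightarrow> 'a"
    using that
    by (intro smooth_on_Pair smooth_on_compose[of _ fst A h] bounded_linear.smooth_on[OF bounded_linear_fst]
        bounded_linear.smooth_on[OF bounded_linear_snd]) (auto intro: open_Times)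
  have "homeomorphism (U \<times> UNIV) (V \<times> UNIV) ?f ?g"
  proof -
    have "continuous_on (U \<times> UNIV) ?f" "continuous_on (V \<times> UNIV) ?g"
      using sm[OF c(1,5)] sm[OF c(3,6)] smooth_on_continuous_on by blast+
    moreover have "?f ` (U \<times> UNIV) = V \<times> UNIV" "?g ` (V \<times> UNIV) = U \<times> UNIV"
      using c(4) unfolding homeomorphism_def by (force simp: image_iff)+
    ultimately show ?thesis using c(4) unfolding homeomorphism_def by auto
  qed
  moreover have "?f ` (U \<times> UNIV \<inter> S \<times> UNIV) = V \<times> UNIV \<inter> L \<times> UNIV"
  proof -
    have "?f ` ((U \<inter> S) \<times> UNIV) = \<phi> ` (U \<inter> S) \<times> UNIV" by (force simp: image_iff)
    then show ?thesis unfolding Times_Int_Times Int_UNIV_right c(9) .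
  qed
  moreover have "dim (L \<times> (UNIV :: real set)) = Suc k"
    using dim_Times[OF c(7) subspace_UNIV[where 'a = real]] c(8) by simp
  moreover have "subspace (L \<times> (UNIV :: real set))"
    by (rule subspace_Times[OF c(7) subspace_UNIV])
  ultimately show "\<exists>U V \<phi> \<psi> (L :: ('a \<times> real) set). open U \<and> q \<in> U \<and> open V \<and> homeomorphism U V \<phi> \<psi> \<and>
      smooth_on U \<phi> \<and> smooth_on V \<psi> \<and> subspace L \<and> dim L = Suc k \<and> \<phi> ` (U \<inter> S \<times> UNIV) = V \<inter> L"
    using c(1-3) sm[OF c(1,5)] sm[OF c(3,6)]
    by (intro exI[of _ "U \<times> UNIV"] exI[of _ "V \<times> UNIV"] exI[of _ ?f] exI[of _ ?g] exI[of _ "L \<times> UNIV"] conjI)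
      (auto intro: open_Times simp: mem_Times_iff)
qed


section \<open>Orthogonal projection onto the tangent planes\<close>

definition orth_proj :: "'a::euclidean_space set \<Rightarrow> 'a \<Rightarrow> 'a" where
  "orth_proj T v = (THE w. w \<in> T \<and> (\<forall>u\<in>T. w \<bullet> u = v \<bullet> u))"

lemma orth_proj_eqI:
  assumes "subspace T" "w \<in> T" "\<And>u. u \<in> T \<Longrightarrow> w \<bullet> u = v \<bullet> u"
  shows "orth_proj T v = w"
  unfolding orth_proj_def
proof (rule the_equality)
  fix w' assume w': "w' \<in> T \<and> (\<forall>u\<in>T. w' \<bullet> u = v \<bullet> u)"
  then have "w' - w \<in> T" using assms(1,2) by (simp add: subspace_diff)
  then have "(w' - w) \<bullet> (w' - w) = 0"
    using w' assms(3) by (simp add: inner_diff_left)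
  then show "w' = w" by simp
qed (use assms in auto)

lemma orth_proj:
  assumes "subspace T"
  shows "orth_proj T v \<in> T" "u \<in> T \<Longrightarrow> orth_proj T v \<bullet> u = v \<bullet> u"
proof -
  obtain y z where "y \<in> span T" "\<And>w. w \<in> span T \<Longrightarrow> orthogonal z w" "v = y + z"
    using orthogonal_subspace_decomp_exists by metis
  then have y: "y \<in> T" "u \<in> T \<Longrightarrow> y \<bullet> u = v \<bullet> u" for u
    using span_eq_iff[THEN iffD2, OF assms] by (auto simp: orthogonal_def inner_add_left)
  then have "orth_proj T v = y" by (rule orth_proj_eqI[OF assms])
  with y show "orth_proj T v \<in> T" "u \<in> T \<Longrightarrow> orth_proj T v \<bullet> u = v \<bullet> u" by auto
qed

lemma orth_proj_ident: "subspace T \<Longrightarrow> v \<in> T \<Longrightarrow> orth_proj T v = v"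
  by (rule orth_proj_eqI) auto

definition gram :: "'a::real_inner \<Rightarrow> 'a \<Rightarrow> real" where
  "gram f g = (f \<bullet> f) * (g \<bullet> g) - (f \<bullet> g)\<^sup>2"

lemma gram_pos:
  fixes f g :: "'a::real_inner"
  assumes "\<And>x y. x *\<^sub>R f + y *\<^sub>R g = 0 \<Longrightarrow> x = 0 \<and> y = 0"
  shows "gram f g > 0"
proof -
  have "f \<noteq> 0" using assms[of 1 0] by auto
  then have ff: "f \<bullet> f > 0" by simp
  \<comment> \<open>Up to a factor, this is the part of \<^term>\<open>g\<close> orthogonal to \<^term>\<open>f\<close>.\<close>
  let ?u = "(- (f \<bullet> g)) *\<^sub>R f + (f \<bullet> f) *\<^sub>R g"
  have "?u \<noteq> 0" using assms[of "- (f \<bullet> g)" "f \<bullet> f"] ff by auto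
  then have "0 < ?u \<bullet> ?u" by simp
  also have "?u \<bullet> ?u = (f \<bullet> f) * gram f g"
    by (simp add: gram_def inner_add_left inner_add_right inner_commute[of g f] algebra_simps power2_eq_square)
  finally show ?thesis using ff by (simp add: zero_less_mult_iff)
qed

lemma smooth_map_gram:
  "smooth_map M f \<Longrightarrow> smooth_map M g \<Longrightarrow> smooth_map M (\<lambda>q. gram (f q) (g q))"
  unfolding gram_def power2_eq_square
  by (intro smooth_map_diff smooth_map_mult smooth_map_inner)

text \<open>Since tangent planes carry no canonical frame, globally defined vector fields are produced by
  projecting functions with values in the ambient space. The projection is smooth because, in a local frame, it is
  given by the inverse of the Gram matrix.\<close>

lemma orth_proj_vector_field:
  assumes "submanifold 2 S" "smooth_map S F"
  shows "(\<lambda>q. orth_proj (tangent_space S q) (F q)) \<in> vector_fields S"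
  unfolding vector_fields_def
proof (intro CollectI conjI ballI)
  show "smooth_map S (\<lambda>q. orth_proj (tangent_space S q) (F q))"
  proof (rule smooth_map_local)
    fix p assume p: "p \<in> S"
    obtain U f g where U: "open U" "p \<in> U"
      and fg: "smooth_map (S \<inter> U) f" "smooth_map (S \<inter> U) g"
        "\<And>q. q \<in> S \<inter> U \<Longrightarrow> f q \<in> tangent_space S q \<and> g q \<in> tangent_space S q"
        "\<And>q v. q \<in> S \<inter> U \<Longrightarrow> v \<in> tangent_space S q \<Longrightarrow> \<exists>x y. v = x *\<^sub>R f q + y *\<^sub>R g q"
        "\<And>q x y. q \<in> S \<inter> U \<Longrightarrow> x *\<^sub>R f q + y *\<^sub>R g q = 0 \<Longrightarrow> x = 0 \<and> y = 0"
      using smooth_tangent_frame[OF assms(1) p] by blast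
    \<comment> \<open>Cramer's rule for the coefficients of the projection in the frame.\<close>
    let ?w = "\<lambda>q. (gram (f q) (g q) powr -1) *\<^sub>R
       (((g q \<bullet> g q) * (F q \<bullet> f q) - (f q \<bullet> g q) * (F q \<bullet> g q)) *\<^sub>R f q +
        ((f q \<bullet> f q) * (F q \<bullet> g q) - (f q \<bullet> g q) * (F q \<bullet> f q)) *\<^sub>R g q)"
    have pos: "gram (f q) (g q) > 0" if "q \<in> S \<inter> U" for q
      by (rule gram_pos) (use fg(5)[OF that] in auto)
    have F: "smooth_map (S \<inter> U) F" by (rule smooth_map_restrict[OF assms(2)]) auto
    have "smooth_map (S \<inter> U) ?w"
      by (intro smooth_map_scaleR smooth_map_add smooth_map_diff smooth_map_mult smooth_map_inner
          smooth_map_powr smooth_map_gram fg(1,2) F pos)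
    moreover have "?w q = orth_proj (tangent_space S q) (F q)" if q: "q \<in> S \<inter> U" for q
    proof (rule orth_proj_eqI[symmetric])
      show T: "subspace (tangent_space S q)" using subspace_dim_tangent_space[OF assms(1)] q by auto
      show "?w q \<in> tangent_space S q"
        using fg(3)[OF q] by (intro subspace_scale[OF T] subspace_add[OF T]) auto
      fix u assume "u \<in> tangent_space S q"
      then obtain x y where u: "u = x *\<^sub>R f q + y *\<^sub>R g q" using fg(4)[OF q] by blast
      define d where "d = gram (f q) (g q)"
      have d: "d powr -1 * d = 1" using pos[OF q] by (simp add: d_def powr_minus)
      have "(k *\<^sub>R (((g q \<bullet> g q) * (F q \<bullet> f q) - (f q \<bullet> g q) * (F q \<bullet> g q)) *\<^sub>R f q +
          ((f q \<bullet> f q) * (F q \<bullet> g q) - (f q \<bullet> g q) * (F q \<bullet> f q)) *\<^sub>R g q)) \<bullet> h = (k * d) * (F q \<bullet> h)"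
        if "h = f q \<or> h = g q" for k h
        using that unfolding d_def
        by (auto simp: gram_def inner_add_left inner_commute[of "g q" "f q"] algebra_simps power2_eq_square)
      then have "?w q \<bullet> f q = (d powr -1 * d) * (F q \<bullet> f q)" "?w q \<bullet> g q = (d powr -1 * d) * (F q \<bullet> g q)"
        unfolding d_def by blast+
      then show "?w q \<bullet> u = F q \<bullet> u" unfolding u d by (simp only: inner_add_right inner_scaleR_right mult_1)
    qed
    ultimately have "smooth_map (S \<inter> U) (\<lambda>q. orth_proj (tangent_space S q) (F q))"
      by (rule smooth_map_cong)
    with U show "\<exists>U. open U \<and> p \<in> U \<and> smooth_map (S \<inter> U) (\<lambda>q. orth_proj (tangent_space S q) (F q))" by blast
  qed
  show "orth_proj (tangent_space S p) (F p) \<in> tangent_space S p" if "p \<in> S" for p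
    using orth_proj(1) subspace_dim_tangent_space[OF assms(1) that] by blast
qed


section \<open>Rotation in the tangent planes\<close>

lemma alternating_form_2:
  assumes "alternating_form 2 V \<omega>"
  shows "x \<in> V \<Longrightarrow> y \<in> V \<Longrightarrow> z \<in> V \<Longrightarrow> \<omega> [x + y, z] = \<omega> [x, z] + \<omega> [y, z]"
    and "x \<in> V \<Longrightarrow> z \<in> V \<Longrightarrow> \<omega> [c *\<^sub>R x, z] = c * \<omega> [x, z]"
    and "x \<in> V \<Longrightarrow> y \<in> V \<Longrightarrow> z \<in> V \<Longrightarrow> \<omega> [z, x + y] = \<omega> [z, x] + \<omega> [z, y]"
    and "x \<in> V \<Longrightarrow> z \<in> V \<Longrightarrow> \<omega> [z, c *\<^sub>R x] = c * \<omega> [z, x]"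
    and "x \<in> V \<Longrightarrow> \<omega> [x, x] = 0"
proof -
  have A: "length us + length vs + 1 = 2 \<Longrightarrow> set us \<union> set vs \<union> {x, y} \<subseteq> V \<Longrightarrow>
        \<omega> (us @ (x + y) # vs) = \<omega> (us @ x # vs) + \<omega> (us @ y # vs) \<and>
        \<omega> (us @ (c *\<^sub>R x) # vs) = c * \<omega> (us @ x # vs)" for us vs x y c
    using assms unfolding alternating_form_def by blast
  show "x \<in> V \<Longrightarrow> y \<in> V \<Longrightarrow> z \<in> V \<Longrightarrow> \<omega> [x + y, z] = \<omega> [x, z] + \<omega> [y, z]"
    using A[of "[]" "[z]" x y] by simp
  show "x \<in> V \<Longrightarrow> z \<in> V \<Longrightarrow> \<omega> [c *\<^sub>R x, z] = c * \<omega> [x, z]"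
    using A[of "[]" "[z]" x x c] by simp
  show "x \<in> V \<Longrightarrow> y \<in> V \<Longrightarrow> z \<in> V \<Longrightarrow> \<omega> [z, x + y] = \<omega> [z, x] + \<omega> [z, y]"
    using A[of "[z]" "[]" x y] by simp
  show "x \<in> V \<Longrightarrow> z \<in> V \<Longrightarrow> \<omega> [z, c *\<^sub>R x] = c * \<omega> [z, x]"
    using A[of "[z]" "[]" x x c] by simp
  show "x \<in> V \<Longrightarrow> \<omega> [x, x] = 0"
    using assms unfolding alternating_form_def by simp
qed

lemma alternating_form_2_combination:
  assumes "alternating_form 2 V \<omega>" "subspace V" "b \<in> V" "c \<in> V"
  shows "\<omega> [x *\<^sub>R b + y *\<^sub>R c, x' *\<^sub>R b + y' *\<^sub>R c] = (x * y' - y * x') * \<omega> [b, c]"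
proof -
  note a = alternating_form_2[OF assms(1)]
  have bc: "b + c \<in> V" using assms by (simp add: subspace_add)
  have "\<omega> [b + c, b + c] = \<omega> [b, b] + \<omega> [b, c] + (\<omega> [c, b] + \<omega> [c, c])"
    using a(1)[OF assms(3,4) bc] a(3)[OF assms(3,4,3)] a(3)[OF assms(3,4,4)] by simp
  then have "\<omega> [c, b] = - \<omega> [b, c]"
    using a(5)[OF bc] a(5)[OF assms(3)] a(5)[OF assms(4)] by simp
  with assms show ?thesis
    by (simp add: a subspace_add subspace_scale algebra_simps)
qed

lemma positive_orthonormal_basis:
  assumes "submanifold 2 S" "orientation_form 2 S \<omega>" "p \<in> S"
  obtains b c where "b \<in> tangent_space S p" "c \<in> tangent_space S p" "b \<bullet> b = 1" "c \<bullet> c = 1" "b \<bullet> c = 0"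
    "\<And>v. v \<in> tangent_space S p \<Longrightarrow> v = (b \<bullet> v) *\<^sub>R b + (c \<bullet> v) *\<^sub>R c" "\<omega> p [b, c] > 0"
proof -
  let ?T = "tangent_space S p"
  note T = subspace_dim_tangent_space[OF assms(1,3)]
  obtain b c where bc: "b \<in> ?T" "c \<in> ?T" "b \<bullet> b = 1" "c \<bullet> c = 1" "b \<bullet> c = 0"
    "\<And>v. v \<in> ?T \<Longrightarrow> v = (b \<bullet> v) *\<^sub>R b + (c \<bullet> v) *\<^sub>R c"
    using dim_2_orthonormal_basis[OF T] by metis
  have "pairwise orthogonal {b, c}" using bc by (auto simp: pairwise_def orthogonal_def inner_commute)
  then have "independent {b, c}" using pairwise_orthogonal_independent bc(3,4) by fastforce
  moreover have "b \<noteq> c" using bc by auto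
  ultimately have ne: "\<omega> p [b, c] \<noteq> 0"
    using assms(2,3) bc(1,2) unfolding orientation_form_def by auto
  have alt: "alternating_form 2 ?T (\<omega> p)" using assms(2,3) unfolding orientation_form_def by blast
  have swap: "\<omega> p [c, b] = - \<omega> p [b, c]"
    using alternating_form_2_combination[OF alt T(1) bc(1,2), of 0 1 1 0] by simp
  show thesis
  proof (cases "\<omega> p [b, c] > 0")
    case True
    with bc that show thesis by blast
  next
    case False
    with ne swap have "\<omega> p [c, b] > 0" by simp
    moreover have "v = (c \<bullet> v) *\<^sub>R c + (b \<bullet> v) *\<^sub>R b" if "v \<in> ?T" for v
      using bc(6)[OF that] by (simp add: add.commute)
    moreover have "c \<bullet> b = 0" using bc(5) by (simp add: inner_commute)
    ultimately show thesis using that[of c b] bc by blast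
  qed
qed

text \<open>In coordinates with respect to a positive orthonormal basis, orthogonality and equality of lengths determine
  the vector up to sign, by Lagrange's identity. The orientation fixes the sign.\<close>

lemma rotation_eqI:
  assumes S: "submanifold 2 S" "orientation_form 2 S \<omega>" "p \<in> S"
    and v: "v \<in> tangent_space S p"
    and w: "w \<in> tangent_space S p" "w \<bullet> v = 0" "w \<bullet> w = v \<bullet> v" "v \<noteq> 0 \<Longrightarrow> \<omega> p [v, w] > 0"
  shows "rotation S induced_metric \<omega> p v = w"
  unfolding rotation_def induced_metric_def
proof (rule the_equality)
  let ?T = "tangent_space S p"
  fix z assume z: "z \<in> ?T \<and> z \<bullet> v = 0 \<and> z \<bullet> z = v \<bullet> v \<and> (v \<noteq> 0 \<longrightarrow> \<omega> p [v, z] > 0)"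
  show "z = w"
  proof (cases "v = 0")
    case True
    then show ?thesis using w z by simp
  next
    case False
    obtain b c where bc: "b \<in> ?T" "c \<in> ?T" "b \<bullet> b = 1" "c \<bullet> c = 1" "b \<bullet> c = 0"
      "\<And>v. v \<in> ?T \<Longrightarrow> v = (b \<bullet> v) *\<^sub>R b + (c \<bullet> v) *\<^sub>R c" and pos: "\<omega> p [b, c] > 0"
      using positive_orthonormal_basis[OF S] by metis
    have alt: "alternating_form 2 ?T (\<omega> p)" using S unfolding orientation_form_def by blast
    define v1 v2 where "v1 = b \<bullet> v" "v2 = c \<bullet> v"
    have v12: "v = v1 *\<^sub>R b + v2 *\<^sub>R c" using bc(6)[OF v] by (simp add: v1_v2_def)
    have ip: "(x *\<^sub>R b + y *\<^sub>R c) \<bullet> (x' *\<^sub>R b + y' *\<^sub>R c) = x * x' + y * y'" for x y x' y'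
      using bc by (simp add: inner_add_left inner_add_right inner_commute[of c b])
    have N: "v1\<^sup>2 + v2\<^sup>2 > 0"
      using False v12 by (metis add.right_neutral scaleR_zero_left sum_power2_gt_zero_iff)
    have u: "u = - v2 *\<^sub>R b + v1 *\<^sub>R c"
      if "u \<in> ?T" "u \<bullet> v = 0" "u \<bullet> u = v \<bullet> v" "\<omega> p [v, u] > 0" for u
    proof -
      define u1 u2 where "u1 = b \<bullet> u" "u2 = c \<bullet> u"
      have u12: "u = u1 *\<^sub>R b + u2 *\<^sub>R c" using bc(6)[OF that(1)] by (simp add: u1_u2_def)
      have 1: "u1 * v1 + u2 * v2 = 0" and 2: "u1\<^sup>2 + u2\<^sup>2 = v1\<^sup>2 + v2\<^sup>2"
        using that(2,3) unfolding u12 v12 ip by (simp_all add: power2_eq_square)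
      \<comment> \<open>The signed area spanned by \<^term>\<open>v\<close> and \<^term>\<open>u\<close>.\<close>
      define D where "D = v1 * u2 - v2 * u1"
      have "D * \<omega> p [b, c] > 0"
        using that(4) subspace_dim_tangent_space(1)[OF S(1,3)] unfolding u12 v12 D_def
        by (simp add: alternating_form_2_combination[OF alt _ bc(1,2)])
      then have "D > 0" using pos by (simp add: zero_less_mult_iff)
      have "D\<^sup>2 = (u1\<^sup>2 + u2\<^sup>2) * (v1\<^sup>2 + v2\<^sup>2) - (u1 * v1 + u2 * v2)\<^sup>2"
        unfolding D_def by (simp add: power2_eq_square algebra_simps)
      also have "\<dots> = (v1\<^sup>2 + v2\<^sup>2)\<^sup>2" unfolding 1 2 by (simp add: power2_eq_square)
      finally have D: "D = v1\<^sup>2 + v2\<^sup>2" using \<open>D > 0\<close> N power2_eq_iff_nonneg[of D "v1\<^sup>2 + v2\<^sup>2"] by simp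
      have "u1 * (v1\<^sup>2 + v2\<^sup>2) = v1 * (u1 * v1 + u2 * v2) - v2 * D"
        "u2 * (v1\<^sup>2 + v2\<^sup>2) = v2 * (u1 * v1 + u2 * v2) + v1 * D"
        unfolding D_def by (simp_all add: power2_eq_square algebra_simps)
      then have "(u1 + v2) * (v1\<^sup>2 + v2\<^sup>2) = 0" "(u2 - v1) * (v1\<^sup>2 + v2\<^sup>2) = 0"
        unfolding 1 D by (simp_all add: algebra_simps)
      then have "u1 = - v2" "u2 = v1" using N by (auto simp: add_eq_0_iff)
      then show ?thesis using u12 by simp
    qed
    show ?thesis using u[of z] u[of w] z w False by simp
  qed
qed (use w in auto)

text \<open>The sign ambiguity of a rotation is resolved by the orientation, and the division by the root of the Gram determinant
  corrects a frame that is not orthonormal. In this form the rotation visibly depends smoothly on the frame.\<close>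

lemma rotation_frame:
  assumes S: "submanifold 2 S" "orientation_form 2 S \<omega>" "p \<in> S"
    and fg: "f \<in> tangent_space S p" "g \<in> tangent_space S p" "\<omega> p [f, g] > 0"
    and v: "v \<in> tangent_space S p"
  shows "rotation S induced_metric \<omega> p v = (gram f g powr (- 1/2)) *\<^sub>R ((f \<bullet> v) *\<^sub>R g - (g \<bullet> v) *\<^sub>R f)"
    and "gram f g > 0"
proof -
  let ?T = "tangent_space S p"
  note T = subspace_dim_tangent_space[OF S(1,3)]
  have alt: "alternating_form 2 ?T (\<omega> p)" using S unfolding orientation_form_def by blast
  note \<omega> = alternating_form_2_combination[OF alt T(1) fg(1,2)]
  have \<omega>0: "\<omega> p [0, u] = 0" "\<omega> p [u, 0] = 0" if "u \<in> ?T" for u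
    using alternating_form_2(2)[OF alt, of u u 0] alternating_form_2(4)[OF alt, of u u 0] that by simp_all
  have ind: "x = 0 \<and> y = 0" if "x *\<^sub>R f + y *\<^sub>R g = 0" for x y
    using \<omega>[of x y 0 1] \<omega>[of 1 0 x y] \<omega>0 fg unfolding that by simp
  show pos: "gram f g > 0" by (rule gram_pos) (rule ind)
  have "f \<noteq> g" using ind[of 1 "-1"] by auto
  have "independent {f, g}"
  proof -
    have "g \<noteq> 0" using ind[of 0 1] by auto
    moreover have "f \<noteq> k *\<^sub>R g" for k using ind[of 1 "- k"] by auto
    ultimately show ?thesis using \<open>f \<noteq> g\<close> by (auto simp: independent_insert span_singleton)
  qed
  then have "?T \<subseteq> span {f, g}"
    using fg T(2) \<open>f \<noteq> g\<close> by (intro card_ge_dim_independent) auto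
  then have "v \<in> span (insert f {g})" using v by auto
  then obtain x where "v - x *\<^sub>R f \<in> span {g}" by (auto simp: span_breakdown_eq)
  then obtain y where "v - x *\<^sub>R f = y *\<^sub>R g" by (auto simp: span_singleton)
  then have vxy: "v = x *\<^sub>R f + y *\<^sub>R g" by (simp add: algebra_simps)
  define r where "r = gram f g powr (- 1/2)"
  have "r * r = gram f g powr -1" unfolding r_def powr_add[symmetric] by simp
  then have r: "r > 0" "r * r * gram f g = 1"
    using pos by (simp_all add: r_def powr_minus)
  define B A where "B = g \<bullet> v" "A = f \<bullet> v"
  have AB: "A = x * (f \<bullet> f) + y * (f \<bullet> g)" "B = x * (f \<bullet> g) + y * (g \<bullet> g)"
    unfolding B_A_def vxy by (simp_all add: inner_add_right inner_commute[of g f])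
  let ?w = "r *\<^sub>R (A *\<^sub>R g - B *\<^sub>R f)"
  have "rotation S induced_metric \<omega> p v = ?w"
  proof (rule rotation_eqI[OF S v])
    show "?w \<in> ?T" using fg T(1) by (intro subspace_scale subspace_diff) auto
    show "?w \<bullet> v = 0" by (simp add: inner_diff_left B_A_def)
    have vv: "v \<bullet> v = x * A + y * B" by (simp add: B_A_def) (simp add: vxy inner_add_left)
    have "?w \<bullet> ?w = (r * r) * (A * A * (g \<bullet> g) - 2 * A * B * (f \<bullet> g) + B * B * (f \<bullet> f))"
      by (simp add: inner_diff_left inner_diff_right inner_commute[of g f] algebra_simps)
    also have "A * A * (g \<bullet> g) - 2 * A * B * (f \<bullet> g) + B * B * (f \<bullet> f) = gram f g * (x * A + y * B)"
      unfolding AB gram_def by (simp add: algebra_simps power2_eq_square)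
    also have "r * r * \<dots> = (r * r * gram f g) * (v \<bullet> v)" unfolding vv by (simp add: algebra_simps)
    finally show "?w \<bullet> ?w = v \<bullet> v" using r by simp
    assume "v \<noteq> 0"
    then have "x * A + y * B > 0" using vv by (metis inner_gt_zero_iff)
    moreover have "\<omega> p [v, ?w] = r * (x * A + y * B) * \<omega> p [f, g]"
      using \<omega>[of x y "- r * B" "r * A"] unfolding vxy[symmetric] by (simp add: algebra_simps)
    ultimately show "\<omega> p [v, ?w] > 0" using r fg by simp
  qed
  then show "rotation S induced_metric \<omega> p v = (gram f g powr (- 1/2)) *\<^sub>R ((f \<bullet> v) *\<^sub>R g - (g \<bullet> v) *\<^sub>R f)"
    unfolding r_def B_A_def .
qed

lemma rotation_orthonormal:
  assumes "submanifold 2 S" "orientation_form 2 S \<omega>" "p \<in> S"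
    and "b \<in> tangent_space S p" "c \<in> tangent_space S p" "\<omega> p [b, c] > 0"
    and "b \<bullet> b = 1" "c \<bullet> c = 1" "b \<bullet> c = 0" "v \<in> tangent_space S p"
  shows "rotation S induced_metric \<omega> p v = (b \<bullet> v) *\<^sub>R c - (c \<bullet> v) *\<^sub>R b"
  using rotation_frame(1)[OF assms(1-6,10)] assms(7-9) by (simp add: gram_def)

lemma rotation:
  assumes "submanifold 2 S" "orientation_form 2 S \<omega>" "p \<in> S" "v \<in> tangent_space S p"
  defines "J \<equiv> rotation S induced_metric \<omega> p"
  shows "J v \<in> tangent_space S p" "J v \<bullet> v = 0" "J v \<bullet> J v = v \<bullet> v" "v \<noteq> 0 \<Longrightarrow> \<omega> p [v, J v] > 0"
    and "u \<in> tangent_space S p \<Longrightarrow> J v \<bullet> u = - (v \<bullet> J u)"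
proof -
  let ?T = "tangent_space S p"
  note S = assms(1-3)
  note T = subspace_dim_tangent_space[OF S(1,3)]
  obtain b c where bc: "b \<in> ?T" "c \<in> ?T" "b \<bullet> b = 1" "c \<bullet> c = 1" "b \<bullet> c = 0"
      "\<And>v. v \<in> ?T \<Longrightarrow> v = (b \<bullet> v) *\<^sub>R b + (c \<bullet> v) *\<^sub>R c" and pos: "\<omega> p [b, c] > 0"
    using positive_orthonormal_basis[OF S] by metis
  have alt: "alternating_form 2 ?T (\<omega> p)" using S unfolding orientation_form_def by blast
  have J: "J u = (b \<bullet> u) *\<^sub>R c - (c \<bullet> u) *\<^sub>R b" if "u \<in> ?T" for u
    unfolding J_def by (rule rotation_orthonormal[OF S bc(1,2) pos bc(3-5) that])
  have vv: "v \<bullet> v = (b \<bullet> v) * (b \<bullet> v) + (c \<bullet> v) * (c \<bullet> v)"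
    by (subst bc(6)[OF assms(4)]) (simp add: inner_add_left)
  show "J v \<in> ?T" unfolding J[OF assms(4)] using bc T by (intro subspace_diff subspace_scale) auto
  show "J v \<bullet> v = 0" unfolding J[OF assms(4)] by (simp add: inner_diff_left)
  show "J v \<bullet> J v = v \<bullet> v" unfolding J[OF assms(4)] vv
    using bc by (simp add: inner_diff_left inner_diff_right inner_commute[of c b])
  show "\<omega> p [v, J v] > 0" if "v \<noteq> 0"
  proof -
    have "\<omega> p [v, J v] = (v \<bullet> v) * \<omega> p [b, c]"
      using alternating_form_2_combination[OF alt T(1) bc(1,2), of "b \<bullet> v" "c \<bullet> v" "- (c \<bullet> v)" "b \<bullet> v"]
      unfolding bc(6)[OF assms(4), symmetric] J[OF assms(4)] vv by (simp add: algebra_simps)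
    then show ?thesis using that pos by simp
  qed
  show "J v \<bullet> u = - (v \<bullet> J u)" if "u \<in> ?T"
    unfolding J[OF assms(4)] J[OF that] by (simp add: inner_diff_left inner_diff_right inner_commute)
qed

text \<open>Near a point, the projections of a positive basis of the tangent plane at that point still form a positive frame, by
  continuity of the orientation form.\<close>

lemma rotation_vector_field:
  assumes S: "submanifold 2 S" "orientation_form 2 S \<omega>" and X: "X \<in> vector_fields S"
  shows "(\<lambda>q. rotation S induced_metric \<omega> q (X q)) \<in> vector_fields S"
  unfolding vector_fields_def
proof (intro CollectI conjI ballI)
  have XT: "X q \<in> tangent_space S q" if "q \<in> S" for q using X that by (simp add: vector_fields_def)
  show "rotation S induced_metric \<omega> q (X q) \<in> tangent_space S q" if "q \<in> S" for q
    using rotation(1)[OF S that XT[OF that]] .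
  show "smooth_map S (\<lambda>q. rotation S induced_metric \<omega> q (X q))"
  proof (rule smooth_map_local)
    fix p assume p: "p \<in> S"
    obtain b c where bc: "b \<in> tangent_space S p" "c \<in> tangent_space S p" and pos: "\<omega> p [b, c] > 0"
      using positive_orthonormal_basis[OF S p] by metis
    let ?E = "\<lambda>e q. orth_proj (tangent_space S q) e"
    have E: "?E e \<in> vector_fields S" for e
      by (rule orth_proj_vector_field[OF S(1) smooth_map_const])
    then have sE: "smooth_map S (?E e)" and TE: "\<And>q. q \<in> S \<Longrightarrow> ?E e q \<in> tangent_space S q" for e
      by (auto simp: vector_fields_def)
    have Ep: "?E e p = e" if "e \<in> tangent_space S p" for e
      using orth_proj_ident subspace_dim_tangent_space[OF S(1) p] that by blast
    let ?h = "\<lambda>q. \<omega> q (map (\<lambda>X. X q) [?E b, ?E c])"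
    have "length Xs = 2 \<Longrightarrow> set Xs \<subseteq> vector_fields S \<Longrightarrow> smooth_map S (\<lambda>q. \<omega> q (map (\<lambda>X. X q) Xs))" for Xs
      using S(2) unfolding orientation_form_def by blast
    from this[of "[?E b, ?E c]"] have "smooth_map S ?h" using E by simp
    then have "continuous_on S ?h" by (rule smooth_map_continuous_on)
    moreover have "?h p \<in> {0<..}" using pos Ep bc by simp
    ultimately obtain U where U: "open U" "p \<in> U" "\<forall>q\<in>S. q \<in> U \<longrightarrow> ?h q \<in> {0<..}"
      using p unfolding continuous_on_topological using open_greaterThan by blast
    have fr: "rotation S induced_metric \<omega> q (X q) =
        (gram (?E b q) (?E c q) powr (- 1/2)) *\<^sub>R ((?E b q \<bullet> X q) *\<^sub>R ?E c q - (?E c q \<bullet> X q) *\<^sub>R ?E b q)"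
        "gram (?E b q) (?E c q) > 0" if "q \<in> S \<inter> U" for q
      using rotation_frame[OF S, of q "?E b q" "?E c q" "X q"] TE XT U(3) that by auto
    have "smooth_map (S \<inter> U) (\<lambda>q. (gram (?E b q) (?E c q) powr (- 1/2)) *\<^sub>R ((?E b q \<bullet> X q) *\<^sub>R ?E c q - (?E c q \<bullet> X q) *\<^sub>R ?E b q))"
    proof -
      have "smooth_map (S \<inter> U) (?E e)" for e by (rule smooth_map_restrict[OF sE]) auto
      moreover have "smooth_map (S \<inter> U) X" by (rule smooth_map_restrict[of S]) (use X in \<open>auto simp: vector_fields_def\<close>)
      ultimately show ?thesis
        by (intro smooth_map_scaleR smooth_map_diff smooth_map_inner smooth_map_powr smooth_map_gram fr(2))
    qed
    then have "smooth_map (S \<inter> U) (\<lambda>q. rotation S induced_metric \<omega> q (X q))"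
      by (rule smooth_map_cong) (use fr(1) in simp)
    with U show "\<exists>U. open U \<and> p \<in> U \<and> smooth_map (S \<inter> U) (\<lambda>q. rotation S induced_metric \<omega> q (X q))" by blast
  qed
qed

section \<open>The Levi-Civita connection and the divergence of a surface\<close>

lemma vector_fieldsD:
  "X \<in> vector_fields M \<Longrightarrow> smooth_map M X"
  "X \<in> vector_fields M \<Longrightarrow> p \<in> M \<Longrightarrow> X p \<in> tangent_space M p"
  by (auto simp: vector_fields_def)

lemma differential_inner:
  assumes "smooth_map M X" "smooth_map M Y" "p \<in> M" "v \<in> tangent_space M p"
  shows "differential M (\<lambda>q. X q \<bullet> Y q) p v = differential M X p v \<bullet> Y p + X p \<bullet> differential M Y p v"
  using differential_eq[OF has_derivative_inner[OF smooth_map_has_derivative[OF assms(1,3)]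
        smooth_map_has_derivative[OF assms(2,3)]] assms(4)] by simp

lemma differential_cong:
  assumes "smooth_map M f" "\<And>q. q \<in> M \<Longrightarrow> f q = g q" "p \<in> M" "v \<in> tangent_space M p"
  shows "differential M f p v = differential M g p v"
proof -
  have "(g has_derivative differential M f p) (at p within M)"
    by (rule has_derivative_transform[OF assms(3) _ smooth_map_has_derivative[OF assms(1,3)]])
      (use assms(2) in simp)
  then show ?thesis using differential_eq[OF _ assms(4)] by metis
qed

lemma levi_civita_bracket_tangent:
  assumes "submanifold k M" "levi_civita M G D" "X \<in> vector_fields M" "Y \<in> vector_fields M" "p \<in> M"
  shows "differential M Y p (X p) - differential M X p (Y p) \<in> tangent_space M p"
proof -
  have "D X Y \<in> vector_fields M" "D Y X \<in> vector_fields M"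
    using assms(2-4) unfolding levi_civita_def affine_connection_def by blast+
  then have "D X Y p - D Y X p \<in> tangent_space M p"
    using vector_fieldsD(2) assms(5) subspace_dim_tangent_space(1)[OF assms(1,5)] by (blast intro: subspace_diff)
  moreover have "D X Y p - D Y X p = lie_bracket M X Y p"
    using assms(2-5) unfolding levi_civita_def by blast
  ultimately show ?thesis by (simp add: lie_bracket_def)
qed

text \<open>Gauss' formula: the Euclidean derivative satisfies the two identities defining the connection, so
  the difference of the two trilinear expressions is symmetric in the first pair of arguments and skew in the last
  pair. Such an expression vanishes.\<close>

lemma levi_civita_induced_metric:
  assumes D: "levi_civita M induced_metric D"
    and "X \<in> vector_fields M" "Y \<in> vector_fields M" "Z \<in> vector_fields M" "p \<in> M"
  shows "D X Y p \<bullet> Z p = differential M Y p (X p) \<bullet> Z p"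
proof -
  define B where "B = (\<lambda>X Y Z. D X Y p \<bullet> Z p - differential M Y p (X p) \<bullet> Z p)"
  have sym: "B X Y Z = B Y X Z" if "X \<in> vector_fields M" "Y \<in> vector_fields M" for X Y Z
  proof -
    have "D X Y p - D Y X p = lie_bracket M X Y p"
      using D that \<open>p \<in> M\<close> unfolding levi_civita_def by blast
    then have "D X Y p - differential M Y p (X p) = D Y X p - differential M X p (Y p)"
      by (simp add: lie_bracket_def algebra_simps)
    then show ?thesis unfolding B_def inner_diff_left[symmetric] by simp
  qed
  have skew: "B X Y Z = - B X Z Y"
    if "X \<in> vector_fields M" "Y \<in> vector_fields M" "Z \<in> vector_fields M" for X Y Z
  proof -
    have "differential M (\<lambda>q. induced_metric q (Y q) (Z q)) p (X p) =
        induced_metric p (D X Y p) (Z p) + induced_metric p (Y p) (D X Z p)"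
      using D that \<open>p \<in> M\<close> unfolding levi_civita_def by blast
    moreover have "differential M (\<lambda>q. Y q \<bullet> Z q) p (X p) =
        differential M Y p (X p) \<bullet> Z p + Y p \<bullet> differential M Z p (X p)"
      using that vector_fieldsD \<open>p \<in> M\<close> by (blast intro: differential_inner)
    ultimately show ?thesis
      unfolding induced_metric_def B_def by (simp add: inner_commute)
  qed
  have "B X Y Z = - B X Z Y" "B X Z Y = B Z X Y" "B Z X Y = - B Z Y X" "B Z Y X = B Y Z X"
    "B Y Z X = - B Y X Z" "B Y X Z = B X Y Z"
    using sym skew assms(2-4) by blast+
  then have "B X Y Z = 0" by linarith
  then show ?thesis by (simp add: B_def)
qed

text \<open>With \<open>P\<close> the projection, \<open>\<langle>P e, P w\<rangle> = \<langle>e, P w\<rangle>\<close>. Differentiating at \<^term>\<open>p\<close>, where \<open>P e = e\<close> and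
  \<open>P w = w\<close>, leaves only the term with the derivative of \<open>P e\<close>.\<close>

lemma orth_proj_parallel_at:
  assumes "submanifold 2 S" "p \<in> S"
    and "e \<in> tangent_space S p" "v \<in> tangent_space S p" "w \<in> tangent_space S p"
  shows "differential S (\<lambda>q. orth_proj (tangent_space S q) e) p v \<bullet> w = 0"
proof -
  let ?E = "\<lambda>e q. orth_proj (tangent_space S q) e"
  have sm: "smooth_map S (?E e)" for e
    using orth_proj_vector_field[OF assms(1) smooth_map_const] by (rule vector_fieldsD)
  have T: "subspace (tangent_space S q)" if "q \<in> S" for q
    using subspace_dim_tangent_space[OF assms(1) that] by simp
  have E: "?E u p = u" if "u \<in> tangent_space S p" for u
    using orth_proj_ident[OF T] assms(2) that by blast
  have "?E e q \<bullet> ?E w q = e \<bullet> ?E w q" if "q \<in> S" for q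
    using orth_proj[OF T[OF that]] by blast
  then have "differential S (\<lambda>q. ?E e q \<bullet> ?E w q) p v = differential S (\<lambda>q. e \<bullet> ?E w q) p v"
    using assms by (intro differential_cong smooth_map_inner sm) auto
  moreover have "differential S (\<lambda>q. e \<bullet> ?E w q) p v = e \<bullet> differential S (?E w) p v"
    using differential_inner[OF smooth_map_const sm, of p v e w] assms by (simp add: differential_const)
  ultimately show ?thesis
    using differential_inner[OF sm sm, of p v e w] assms by (simp add: E)
qed

text \<open>The exterior derivative at \<^term>\<open>p\<close> of the one-form dual to \<^term>\<open>A\<close>.\<close>

definition curl :: "'a::euclidean_space set \<Rightarrow> ('a \<Rightarrow> 'a) \<Rightarrow> 'a \<Rightarrow> 'a \<Rightarrow> 'a \<Rightarrow> real" where
  "curl S A p u v = differential S A p u \<bullet> v - differential S A p v \<bullet> u"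

text \<open>An alternating bilinear form on a plane is a multiple of the area form \<open>\<langle>J u, v\<rangle>\<close>.\<close>

lemma curl_rotation:
  assumes S: "submanifold 2 S" "orientation_form 2 S \<omega>" "p \<in> S" and "smooth_map S A"
    and bc: "b \<in> tangent_space S p" "c \<in> tangent_space S p" "\<omega> p [b, c] > 0"
      "b \<bullet> b = 1" "c \<bullet> c = 1" "b \<bullet> c = 0" "\<And>v. v \<in> tangent_space S p \<Longrightarrow> v = (b \<bullet> v) *\<^sub>R b + (c \<bullet> v) *\<^sub>R c"
    and uv: "u \<in> tangent_space S p" "v \<in> tangent_space S p"
  shows "curl S A p u v = curl S A p b c * (rotation S induced_metric \<omega> p u \<bullet> v)"
proof -
  have lin: "linear (differential S A p)"
    by (rule has_derivative_linear[OF smooth_map_has_derivative[OF assms(4,3)]])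
  have comb: "curl S A p (x *\<^sub>R b + y *\<^sub>R c) (x' *\<^sub>R b + y' *\<^sub>R c) = curl S A p b c * (x * y' - y * x')" for x y x' y'
    unfolding curl_def by (simp add: linear_add[OF lin] linear_scale[OF lin] inner_add_left inner_add_right algebra_simps)
  have "rotation S induced_metric \<omega> p u \<bullet> v = (b \<bullet> u) * (c \<bullet> v) - (c \<bullet> u) * (b \<bullet> v)"
    unfolding rotation_orthonormal[OF S bc(1-6) uv(1)] by (simp add: inner_diff_left)
  then show ?thesis
    using comb[of "b \<bullet> u" "c \<bullet> u" "b \<bullet> v" "c \<bullet> v"] unfolding bc(7)[OF uv(1), symmetric] bc(7)[OF uv(2), symmetric] by simp
qed

text \<open>Extend a positive orthonormal basis \<^term>\<open>b\<close>, \<^term>\<open>c\<close> by projection to fields which are parallel at \<^term>\<open>p\<close>.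
  Their rotations are parallel at \<^term>\<open>p\<close> as well, being determined by orthogonality and length. The normal part of
  \<open>\<partial>\<^sub>b (J b) + \<partial>\<^sub>c (J c)\<close> also vanishes, because this vector is, up to sign, a Lie bracket of tangent fields; this is the
  symmetry of the second fundamental form. Hence, when \<open>W \<bullet> b = A \<bullet> J b\<close> is differentiated, only
  the derivatives of \<^term>\<open>A\<close> survive.\<close>

lemma trace_differential_eq_curl:
  assumes S: "submanifold 2 S" "orientation_form 2 S \<omega>" "levi_civita S induced_metric D" and p: "p \<in> S"
    and A: "smooth_map S A" and W: "W \<in> vector_fields S"
    and WA: "\<And>q u. q \<in> S \<Longrightarrow> u \<in> tangent_space S q \<Longrightarrow> W q \<bullet> u = A q \<bullet> rotation S induced_metric \<omega> q u"
    and bc: "b \<in> tangent_space S p" "c \<in> tangent_space S p" "\<omega> p [b, c] > 0"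
      "b \<bullet> b = 1" "c \<bullet> c = 1" "b \<bullet> c = 0" "\<And>v. v \<in> tangent_space S p \<Longrightarrow> v = (b \<bullet> v) *\<^sub>R b + (c \<bullet> v) *\<^sub>R c"
  shows "differential S W p b \<bullet> b + differential S W p c \<bullet> c = curl S A p b c"
proof -
  let ?T = "tangent_space S p" and ?d = "\<lambda>F. differential S F p"
  let ?J = "rotation S induced_metric \<omega>"
  define E where "E = (\<lambda>e q. orth_proj (tangent_space S q) e)"
  define F where "F = (\<lambda>e q. ?J q (E e q))"
  have Evf: "E e \<in> vector_fields S" for e
    unfolding E_def by (rule orth_proj_vector_field[OF S(1) smooth_map_const])
  then have Fvf: "F e \<in> vector_fields S" for e
    unfolding F_def by (rule rotation_vector_field[OF S(1,2)])
  note Es = vector_fieldsD(1)[OF Evf] and ET = vector_fieldsD(2)[OF Evf]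
  note Fs = vector_fieldsD(1)[OF Fvf] and FT = vector_fieldsD(2)[OF Fvf]
  note T = subspace_dim_tangent_space[OF S(1) p]
  have Ep: "E e p = e" if "e \<in> ?T" for e
    unfolding E_def by (rule orth_proj_ident[OF T(1) that])
  have Jb: "?J p b = c" and Jc: "?J p c = - b"
    using rotation_orthonormal[OF S(1,2) p bc(1-6)] bc by (simp_all add: inner_commute[of c b])
  have E0: "?d (E e) v \<bullet> w = 0" if "e \<in> ?T" "v \<in> ?T" "w \<in> ?T" for e v w
    unfolding E_def by (rule orth_proj_parallel_at[OF S(1) p that])
  have F0: "?d (F e) v \<bullet> e = 0" "?d (F e) v \<bullet> ?J p e = 0" if e: "e \<in> ?T" and v: "v \<in> ?T" for e v
  proof -
    have Je: "?J p e \<in> ?T" by (rule rotation(1)[OF S(1,2) p e])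
    have "?d (\<lambda>q. F e q \<bullet> E e q) v = ?d (\<lambda>q. 0::real) v"
      by (rule differential_cong[OF smooth_map_inner[OF Fs Es] _ p v])
        (use rotation(2)[OF S(1,2) _ ET] in \<open>simp add: F_def\<close>)
    then have "?d (F e) v \<bullet> E e p + F e p \<bullet> ?d (E e) v = 0"
      using differential_inner[OF Fs Es p v] differential_const[OF v] by metis
    then show "?d (F e) v \<bullet> e = 0" using E0[OF e v Je] by (simp add: F_def Ep[OF e] inner_commute)
    have "?d (\<lambda>q. F e q \<bullet> F e q) v = ?d (\<lambda>q. E e q \<bullet> E e q) v"
      by (rule differential_cong[OF smooth_map_inner[OF Fs Fs] _ p v])
        (use rotation(3)[OF S(1,2) _ ET] in \<open>simp add: F_def\<close>)
    then have "?d (F e) v \<bullet> F e p + F e p \<bullet> ?d (F e) v = ?d (E e) v \<bullet> E e p + E e p \<bullet> ?d (E e) v"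
      using differential_inner[OF Fs Fs p v] differential_inner[OF Es Es p v] by metis
    then show "?d (F e) v \<bullet> ?J p e = 0" using E0[OF e v e] by (simp add: F_def Ep[OF e] inner_commute)
  qed
  have Fp: "F b p = c" "F c p = - b" using bc by (simp_all add: F_def Ep Jb Jc)
  have dlin: "linear (?d (F e))" for e
    by (rule has_derivative_linear[OF smooth_map_has_derivative[OF Fs p]])
  define N where "N = ?d (F b) b + ?d (F c) c"
  \<comment> \<open>The bracket of \<open>J c\<close> and \<open>J b\<close>; at \<^term>\<open>p\<close> these fields have the values \<open>- b\<close> and \<open>c\<close>.\<close>
  have "?d (F b) (F c p) - ?d (F c) (F b p) \<in> ?T"
    by (rule levi_civita_bracket_tangent[OF S(1,3) Fvf Fvf p])
  then have "- N \<in> ?T" unfolding Fp N_def by (simp add: linear_neg[OF dlin])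
  then have "N \<in> ?T" using subspace_neg[OF T(1)] by fastforce
  moreover have "N \<bullet> b = 0" "N \<bullet> c = 0"
    unfolding N_def inner_add_left using F0[OF bc(1,1)] F0[OF bc(2,2)] by (simp_all add: Jb Jc)
  ultimately have N: "N = 0" using bc(7)[of N] by (simp add: inner_commute)
  have W': "?d W e \<bullet> e = ?d A e \<bullet> ?J p e + A p \<bullet> ?d (F e) e" if e: "e \<in> ?T" for e
  proof -
    have "?d (\<lambda>q. W q \<bullet> E e q) e = ?d (\<lambda>q. A q \<bullet> F e q) e"
      by (rule differential_cong[OF smooth_map_inner[OF vector_fieldsD(1)[OF W] Es] _ p e])
        (use WA ET in \<open>simp add: F_def\<close>)
    then have "?d W e \<bullet> E e p + W p \<bullet> ?d (E e) e = ?d A e \<bullet> F e p + A p \<bullet> ?d (F e) e"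
      using differential_inner[OF vector_fieldsD(1)[OF W] Es p e] differential_inner[OF A Fs p e] by metis
    moreover have "W p \<bullet> ?d (E e) e = 0"
      using E0[OF e e vector_fieldsD(2)[OF W p]] by (simp add: inner_commute)
    ultimately show ?thesis by (simp add: F_def Ep[OF e])
  qed
  have "?d W b \<bullet> b + ?d W c \<bullet> c = (?d A b \<bullet> c - ?d A c \<bullet> b) + A p \<bullet> N"
    unfolding W'[OF bc(1)] W'[OF bc(2)] Jb Jc N_def by (simp add: inner_add_right)
  then show ?thesis by (simp add: N curl_def)
qed

text \<open>The trace of the differential is the same over every orthonormal basis, whichever its orientation: a negative
  basis becomes positive when its members are exchanged, and all positive ones give the same value of
  the curl. This is also what makes the divergence well defined.\<close>

lemma curl_eq_divergence:
  assumes S: "submanifold 2 S" "orientation_form 2 S \<omega>" "levi_civita S induced_metric D" and p: "p \<in> S"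
    and A: "smooth_map S A" and W: "W \<in> vector_fields S"
    and WA: "\<And>q u. q \<in> S \<Longrightarrow> u \<in> tangent_space S q \<Longrightarrow> W q \<bullet> u = A q \<bullet> rotation S induced_metric \<omega> q u"
    and uv: "u \<in> tangent_space S p" "v \<in> tangent_space S p"
  shows "curl S A p u v = divergence 2 S induced_metric D W p * (rotation S induced_metric \<omega> p u \<bullet> v)"
proof -
  let ?T = "tangent_space S p"
  note T = subspace_dim_tangent_space[OF S(1) p]
  obtain b c where bc: "b \<in> ?T" "c \<in> ?T" "b \<bullet> b = 1" "c \<bullet> c = 1" "b \<bullet> c = 0"
      "\<And>v. v \<in> ?T \<Longrightarrow> v = (b \<bullet> v) *\<^sub>R b + (c \<bullet> v) *\<^sub>R c" and pos: "\<omega> p [b, c] > 0"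
    using positive_orthonormal_basis[OF S(1,2) p] by metis
  have rot: "curl S A p u v = curl S A p b c * (rotation S induced_metric \<omega> p u \<bullet> v)"
    if "u \<in> ?T" "v \<in> ?T" for u v
    by (rule curl_rotation[OF S(1,2) p A bc(1,2) pos bc(3-6) that])
  have rep: "v = (x \<bullet> v) *\<^sub>R x + (y \<bullet> v) *\<^sub>R y"
    if "x \<in> ?T" "y \<in> ?T" "x \<bullet> x = 1" "y \<bullet> y = 1" "x \<bullet> y = 0" "\<omega> p [x, y] > 0" "v \<in> ?T" for x y v
  proof -
    \<comment> \<open>A tangent vector orthogonal to both basis vectors has rotation zero, hence length zero.\<close>
    let ?r = "v - ((x \<bullet> v) *\<^sub>R x + (y \<bullet> v) *\<^sub>R y)"
    have r: "?r \<in> ?T" using that T(1) by (intro subspace_diff subspace_add subspace_scale) auto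
    have "?r \<bullet> x = 0" "?r \<bullet> y = 0"
      using that by (simp_all add: inner_diff_left inner_add_left inner_commute[of y x] inner_commute[of v])
    then have "rotation S induced_metric \<omega> p ?r = 0"
      using rotation_orthonormal[OF S(1,2) p that(1,2,6,3-5) r] by (simp add: inner_commute)
    then have "?r \<bullet> ?r = 0" using rotation(3)[OF S(1,2) p r] by simp
    then show ?thesis by simp
  qed
  have pair: "differential S W p x \<bullet> x + differential S W p y \<bullet> y = curl S A p b c"
    if "x \<in> ?T" "y \<in> ?T" "x \<bullet> x = 1" "y \<bullet> y = 1" "x \<bullet> y = 0" "\<omega> p [x, y] > 0" for x y
  proof -
    have "rotation S induced_metric \<omega> p x = y"
      using rotation_orthonormal[OF S(1,2) p that(1,2,6,3-5) that(1)] that by (simp add: inner_commute)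
    then have "curl S A p x y = curl S A p b c" using rot[OF that(1,2)] that(4) by simp
    with trace_differential_eq_curl[OF S p A W WA that(1,2,6,3-5) rep[OF that]] show ?thesis by simp
  qed
  have "divergence 2 S induced_metric D W p = curl S A p b c"
    unfolding divergence_def
  proof (rule the_equality)
    show "\<forall>Es. length Es = 2 \<and> set Es \<subseteq> vector_fields S \<and> orthonormal_at induced_metric p (map (\<lambda>E. E p) Es) \<longrightarrow>
        curl S A p b c = (\<Sum>E\<leftarrow>Es. induced_metric p (D E W p) (E p))"
    proof (intro allI impI)
      fix Es assume Es: "length Es = 2 \<and> set Es \<subseteq> vector_fields S \<and>
        orthonormal_at induced_metric p (map (\<lambda>E. E p) Es)"
      then obtain X Y where XY: "Es = [X, Y]" by (auto simp: numeral_2_eq_2 length_Suc_conv)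
      with Es have vf: "X \<in> vector_fields S" "Y \<in> vector_fields S" by auto
      then have xy: "X p \<in> ?T" "Y p \<in> ?T" using vector_fieldsD(2) p by blast+
      have o: "X p \<bullet> X p = 1" "Y p \<bullet> Y p = 1" "X p \<bullet> Y p = 0"
        using Es unfolding XY orthonormal_at_def induced_metric_def by (auto simp: less_Suc_eq)
      have s: "(\<Sum>E\<leftarrow>Es. induced_metric p (D E W p) (E p)) =
          differential S W p (X p) \<bullet> X p + differential S W p (Y p) \<bullet> Y p"
        unfolding XY induced_metric_def using levi_civita_induced_metric[OF S(3)] vf W p by simp
      have alt: "alternating_form 2 ?T (\<omega> p)" using S p unfolding orientation_form_def by blast
      have sw: "\<omega> p [Y p, X p] = - \<omega> p [X p, Y p]"
        using alternating_form_2_combination[OF alt T(1) xy, of 0 1 1 0] by simp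
      have "pairwise orthogonal {X p, Y p}" using o by (auto simp: pairwise_def orthogonal_def inner_commute)
      then have "independent {X p, Y p}" using pairwise_orthogonal_independent o by fastforce
      moreover have "X p \<noteq> Y p" using o by auto
      ultimately have "\<omega> p [X p, Y p] \<noteq> 0"
        using S(2) p xy unfolding orientation_form_def by auto
      then consider "\<omega> p [X p, Y p] > 0" | "\<omega> p [Y p, X p] > 0" using sw by linarith
      then show "curl S A p b c = (\<Sum>E\<leftarrow>Es. induced_metric p (D E W p) (E p))"
      proof cases
        case 1
        show ?thesis unfolding s using pair[OF xy o 1] by simp
      next
        case 2
        have "Y p \<bullet> X p = 0" using o by (simp add: inner_commute)
        from pair[OF xy(2,1) o(2,1) this 2] show ?thesis unfolding s by simp
      qed
    qed
    let ?E = "\<lambda>e q. orth_proj (tangent_space S q) e"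
    fix d assume d: "\<forall>Es. length Es = 2 \<and> set Es \<subseteq> vector_fields S \<and>
        orthonormal_at induced_metric p (map (\<lambda>E. E p) Es) \<longrightarrow>
        d = (\<Sum>E\<leftarrow>Es. induced_metric p (D E W p) (E p))"
    have vf: "?E e \<in> vector_fields S" for e
      by (rule orth_proj_vector_field[OF S(1) smooth_map_const])
    have E: "?E b p = b" "?E c p = c" using orth_proj_ident[OF T(1)] bc by auto
    have "orthonormal_at induced_metric p (map (\<lambda>E. E p) [?E b, ?E c])"
      using bc unfolding orthonormal_at_def induced_metric_def by (auto simp: E less_Suc_eq inner_commute)
    then have "d = (\<Sum>E\<leftarrow>[?E b, ?E c]. induced_metric p (D E W p) (E p))"
      using d[rule_format, of "[?E b, ?E c]"] vf by simp
    also have "\<dots> = differential S W p b \<bullet> b + differential S W p c \<bullet> c"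
      unfolding induced_metric_def
      using levi_civita_induced_metric[OF S(3) vf W vf p, of b b] levi_civita_induced_metric[OF S(3) vf W vf p, of c c]
      by (simp add: E)
    also have "\<dots> = curl S A p b c" by (rule pair[OF bc(1-5) pos])
    finally show "d = curl S A p b c" .
  qed
  then show ?thesis using rot[OF uv] by simp
qed

section \<open>Killing fields and the Levi-Civita connection\<close>

lemma riemannian_metricD:
  assumes "riemannian_metric M G" "p \<in> M"
    and "u \<in> tangent_space M p" "v \<in> tangent_space M p" "w \<in> tangent_space M p"
  shows "G p (u + v) w = G p u w + G p v w" "G p u v = G p v u"
  using assms unfolding riemannian_metric_def by blast+

text \<open>For a Killing field, the covariant derivative is skew, so it is half the exterior derivative of the dual
  one-form; the connection then enters only through the Lie bracket.\<close>

lemma killing_field_covariant_derivative: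
  assumes "submanifold k M" "riemannian_metric M G" "levi_civita M G D" "killing_field M G \<xi>"
    and X: "X \<in> vector_fields M" and Y: "Y \<in> vector_fields M" and p: "p \<in> M"
  shows "2 * G p (D X \<xi> p) (Y p) =
    differential M (\<lambda>q. G q (\<xi> q) (Y q)) p (X p) - differential M (\<lambda>q. G q (\<xi> q) (X q)) p (Y p)
    - G p (\<xi> p) (lie_bracket M X Y p)"
proof -
  have \<xi>: "\<xi> \<in> vector_fields M" using assms(4) by (simp add: killing_field_def)
  have "D Z W \<in> vector_fields M" if "Z \<in> vector_fields M" "W \<in> vector_fields M" for Z W
    using assms(3) that unfolding levi_civita_def affine_connection_def by blast
  then have DT: "D Z W p \<in> tangent_space M p" if "Z \<in> vector_fields M" "W \<in> vector_fields M" for Z W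
    using that p vector_fieldsD(2) by blast
  have T: "W p \<in> tangent_space M p" if "W \<in> vector_fields M" for W
    using that p by (rule vector_fieldsD(2))
  have tor: "D Z W p = D W Z p + lie_bracket M Z W p"
    if "Z \<in> vector_fields M" "W \<in> vector_fields M" for Z W
  proof -
    have "D Z W p - D W Z p = lie_bracket M Z W p"
      using assms(3) that p unfolding levi_civita_def by blast
    then show ?thesis by (simp add: algebra_simps)
  qed
  have LT: "lie_bracket M Z W p \<in> tangent_space M p"
    if "Z \<in> vector_fields M" "W \<in> vector_fields M" for Z W
    unfolding lie_bracket_def by (rule levi_civita_bracket_tangent[OF assms(1,3) that p])
  have met: "differential M (\<lambda>q. G q (V q) (W q)) p (Z p) = G p (D Z V p) (W p) + G p (V p) (D Z W p)"
    if "Z \<in> vector_fields M" "V \<in> vector_fields M" "W \<in> vector_fields M" for Z V W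
    using assms(3) that p unfolding levi_civita_def by blast
  have add: "G p (u + v) w = G p u w + G p v w" and sym: "G p u v = G p v u"
    if "u \<in> tangent_space M p" "v \<in> tangent_space M p" "w \<in> tangent_space M p" for u v w
    using riemannian_metricD[OF assms(2) p that] .
  \<comment> \<open>The Killing equation with brackets replaced by covariant derivatives; the derivatives along \<^term>\<open>\<xi>\<close> cancel.\<close>
  have "differential M (\<lambda>q. G q (X q) (Y q)) p (\<xi> p) =
      G p (lie_bracket M \<xi> X p) (Y p) + G p (X p) (lie_bracket M \<xi> Y p)"
    using assms(4) X Y p unfolding killing_field_def by blast
  then have skew: "G p (D X \<xi> p) (Y p) + G p (D Y \<xi> p) (X p) = 0"
    using met[OF \<xi> X Y] tor[OF \<xi> X] tor[OF \<xi> Y]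
      add[OF DT[OF X \<xi>] LT[OF \<xi> X] T[OF Y]] add[OF DT[OF Y \<xi>] LT[OF \<xi> Y] T[OF X]]
      sym[OF T[OF X] LT[OF \<xi> Y] T[OF X]] sym[OF T[OF X] DT[OF \<xi> Y] T[OF X]] by simp
  have "G p (\<xi> p) (D X Y p) = G p (\<xi> p) (D Y X p) + G p (\<xi> p) (lie_bracket M X Y p)"
    using tor[OF X Y] add[OF DT[OF Y X] LT[OF X Y] T[OF \<xi>]] sym[OF T[OF \<xi>] DT[OF X Y] T[OF \<xi>]]
      sym[OF T[OF \<xi>] DT[OF Y X] T[OF \<xi>]] sym[OF T[OF \<xi>] LT[OF X Y] T[OF \<xi>]] by simp
  with skew met[OF X \<xi> Y] met[OF Y \<xi> X] show ?thesis by simp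
qed


section \<open>The Killing submersion defined by a one-form\<close>

definition bundle_metric :: "('a::euclidean_space \<Rightarrow> 'a) \<Rightarrow> ('a \<times> real) metric" where
  "bundle_metric A q u v =
    fst u \<bullet> fst v + (snd u - A (fst q) \<bullet> fst u) * (snd v - A (fst q) \<bullet> fst v)"

lemma ds2_eq_bundle_metric: "ds2 a = bundle_metric (\<lambda>x. \<chi> k. a k x)"
  by (intro ext) (auto simp: ds2_def bundle_metric_def inner_vec_def split: prod.splits)

lemma smooth_map_vec_lambda:
  fixes a :: "'n::finite \<Rightarrow> real^'n \<Rightarrow> real"
  assumes "\<And>k. smooth_on UNIV (a k)"
  shows "smooth_map S (\<lambda>x. \<chi> k. a k x)"
proof -
  have "smooth_on UNIV (\<lambda>x. \<Sum>k\<in>UNIV. a k x *\<^sub>R (axis k 1 :: real^'n))"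
    by (intro smooth_on_sum bounded_bilinear.smooth_on_prod[OF bounded_bilinear_scaleR] smooth_on_const assms) auto
  moreover have "(\<Sum>k\<in>UNIV. a k x *\<^sub>R (axis k 1 :: real^'n)) = (\<chi> k. a k x)" for x
    by (simp add: vec_eq_iff axis_def if_distrib cong: if_cong)
  ultimately show ?thesis by (intro smooth_on_imp_smooth_map[OF open_UNIV]) auto
qed

lemma bundle_metric_pos: "v \<noteq> 0 \<Longrightarrow> bundle_metric A q v v > 0"
proof (cases "fst v = 0")
  case True
  assume "v \<noteq> 0"
  with True have "snd v \<noteq> 0" by (metis prod.collapse zero_prod_def)
  with True show ?thesis by (simp add: bundle_metric_def flip: power2_eq_square)
next
  case False
  then show ?thesis by (simp add: bundle_metric_def add_pos_nonneg)
qed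

lemma riemannian_metric_bundle_metric:
  assumes "smooth_map S A"
  shows "riemannian_metric (S \<times> UNIV) (bundle_metric A)"
  unfolding riemannian_metric_def
proof (intro conjI ballI allI impI)
  fix X Y :: "'a \<times> real \<Rightarrow> 'a \<times> real"
  assume "X \<in> vector_fields (S \<times> UNIV)" "Y \<in> vector_fields (S \<times> UNIV)"
  then have "smooth_map (S \<times> UNIV) X" "smooth_map (S \<times> UNIV) Y" by (auto dest: vector_fieldsD)
  then show "smooth_map (S \<times> UNIV) (\<lambda>p. bundle_metric A p (X p) (Y p))"
    unfolding bundle_metric_def
    by (intro smooth_map_add smooth_map_mult smooth_map_diff smooth_map_inner
        smooth_map_compose[OF smooth_map_fst assms] smooth_map_compose[OF _ smooth_map_fst subset_UNIV]
        smooth_map_compose[OF _ smooth_map_snd subset_UNIV]) auto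
qed (auto simp: bundle_metric_pos, auto simp: bundle_metric_def inner_add_left inner_add_right inner_commute algebra_simps)

lemma riemannian_metric_induced_metric: "riemannian_metric S induced_metric"
  unfolding riemannian_metric_def induced_metric_def
  by (auto simp: inner_add_left inner_add_right inner_commute intro!: smooth_map_inner dest: vector_fieldsD)

lemma tangent_space_product:
  "q \<in> S \<times> UNIV \<Longrightarrow> tangent_space (S \<times> (UNIV :: real set)) q = tangent_space S (fst q) \<times> UNIV"
  using tangent_space_Times_UNIV[of S "fst q" "snd q"] by simp

lemma differential_fst:
  "v \<in> tangent_space M q \<Longrightarrow> differential M fst q v = fst v"
  by (rule differential_eq) (auto intro: has_derivative_fst)

context
  fixes S :: "'a::euclidean_space set" and k :: nat
  assumes S: "submanifold k S"
begin

lemma vertical_space_product: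
  "q \<in> S \<times> UNIV \<Longrightarrow> vertical_space (S \<times> UNIV) fst q = {0} \<times> (UNIV :: real set)"
  using subspace_0[OF subspace_dim_tangent_space(1)[OF S]]
  by (auto simp: vertical_space_def differential_fst tangent_space_product)

lemma horizontal_space_bundle_metric:
  assumes "q \<in> S \<times> UNIV"
  shows "horizontal_space (S \<times> UNIV) (bundle_metric A) fst q =
    {u. fst u \<in> tangent_space S (fst q) \<and> snd u = A (fst q) \<bullet> fst u}"
  unfolding horizontal_space_def vertical_space_product[OF assms] tangent_space_product[OF assms]
  by (auto simp: bundle_metric_def)

lemma is_horizontal_lift_bundle_metric:
  assumes "q \<in> S \<times> UNIV" "e \<in> tangent_space S (fst q)"
  shows "is_horizontal_lift (S \<times> UNIV) (bundle_metric A) fst q e (e, A (fst q) \<bullet> e)"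
  using assms
  by (auto simp: is_horizontal_lift_def horizontal_space_bundle_metric differential_fst tangent_space_product)

lemma riemannian_submersion_bundle_metric:
  "riemannian_submersion (S \<times> UNIV) (bundle_metric A) S induced_metric fst"
proof -
  have "differential (S \<times> UNIV) fst q ` tangent_space (S \<times> UNIV) q = tangent_space S (fst q)"
    if "q \<in> S \<times> (UNIV :: real set)" for q
  proof -
    have "differential (S \<times> UNIV) fst q ` tangent_space (S \<times> UNIV) q =
        fst ` tangent_space (S \<times> (UNIV :: real set)) q"
      by (intro image_cong) (auto simp: differential_fst)
    then show ?thesis by (simp add: tangent_space_product[OF that])
  qed
  moreover have "induced_metric (fst q) (differential (S \<times> UNIV) fst q u) (differential (S \<times> UNIV) fst q u) =
      bundle_metric A q u u"
    if q: "q \<in> S \<times> (UNIV :: real set)" and u: "u \<in> horizontal_space (S \<times> UNIV) (bundle_metric A) fst q" for q u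
  proof -
    have "u \<in> tangent_space (S \<times> UNIV) q" using u by (simp add: horizontal_space_def)
    then show ?thesis using u unfolding horizontal_space_bundle_metric[OF q]
      by (simp add: differential_fst induced_metric_def bundle_metric_def)
  qed
  ultimately show ?thesis
    by (simp add: riemannian_submersion_def submersion_onto_def smooth_map_fst)
qed

lemma vertical_field: "(\<lambda>q. (0, 1)) \<in> vector_fields (S \<times> (UNIV :: real set))"
  using subspace_0[OF subspace_dim_tangent_space(1)[OF S]]
  by (auto simp: vector_fields_def smooth_map_const tangent_space_product)

lemma lie_bracket_vertical_field:
  assumes "X \<in> vector_fields (S \<times> UNIV)" "q \<in> S \<times> (UNIV :: real set)"
  shows "lie_bracket (S \<times> UNIV) (\<lambda>q. (0, 1)) X q = differential (S \<times> UNIV) X q (0, 1)"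
  using differential_const[OF vector_fieldsD(2)[OF assms]] by (simp add: lie_bracket_def)

end

lemma has_derivative_connection_form:
  fixes S :: "'a::euclidean_space set"
  assumes A: "smooth_map S A" and X: "smooth_map (S \<times> UNIV) X" and q: "q \<in> S \<times> (UNIV :: real set)"
  shows "((\<lambda>q. snd (X q) - A (fst q) \<bullet> fst (X q)) has_derivative
      (\<lambda>v. snd (differential (S \<times> UNIV) X q v) - (differential S A (fst q) (fst v) \<bullet> fst (X q)
        + A (fst q) \<bullet> fst (differential (S \<times> UNIV) X q v)))) (at q within S \<times> UNIV)"
proof -
  have X': "(X has_derivative differential (S \<times> UNIV) X q) (at q within S \<times> UNIV)"
    by (rule smooth_map_has_derivative[OF X q])
  have "(A has_derivative differential S A (fst q)) (at (fst q) within fst ` (S \<times> (UNIV :: real set)))"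
    using smooth_map_has_derivative[OF A] q by auto
  with has_derivative_fst[OF has_derivative_ident]
  have A': "((\<lambda>q. A (fst q)) has_derivative (\<lambda>v. differential S A (fst q) (fst v))) (at q within S \<times> UNIV)"
    by (rule has_derivative_in_compose)
  show ?thesis
    using has_derivative_diff[OF has_derivative_snd[OF X'] has_derivative_inner[OF A' has_derivative_fst[OF X']]]
    by (simp add: add.commute)
qed

text \<open>The coefficients of the metric do not depend on the coordinate of the fibre.\<close>

lemma killing_field_bundle_metric:
  fixes S :: "'a::euclidean_space set"
  assumes S: "submanifold k S" and A: "smooth_map S A"
  shows "killing_field (S \<times> UNIV) (bundle_metric A) (\<lambda>q. (0, 1))"
  unfolding killing_field_def
proof (intro conjI ballI)
  show "(\<lambda>q. (0, 1)) \<in> vector_fields (S \<times> (UNIV :: real set))" by (rule vertical_field[OF S])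
  fix X Y :: "'a \<times> real \<Rightarrow> 'a \<times> real" and q :: "'a \<times> real"
  assume X: "X \<in> vector_fields (S \<times> UNIV)" and Y: "Y \<in> vector_fields (S \<times> UNIV)" and q: "q \<in> S \<times> UNIV"
  let ?d = "\<lambda>X. differential (S \<times> (UNIV :: real set)) X q"
  have v: "(0, 1) \<in> tangent_space (S \<times> (UNIV :: real set)) q"
    using vector_fieldsD(2)[OF vertical_field[OF S] q] .
  have lin: "linear (differential S A (fst q))"
    using has_derivative_linear[OF smooth_map_has_derivative[OF A]] q by auto
  note sX = vector_fieldsD(1)[OF X] and sY = vector_fieldsD(1)[OF Y]
  have "((\<lambda>r. bundle_metric A r (X r) (Y r)) has_derivative
      (\<lambda>v. fst (X q) \<bullet> fst (?d Y v) + fst (?d X v) \<bullet> fst (Y q) +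
        ((snd (X q) - A (fst q) \<bullet> fst (X q)) * (snd (?d Y v) - (differential S A (fst q) (fst v) \<bullet> fst (Y q) + A (fst q) \<bullet> fst (?d Y v)))
         + (snd (?d X v) - (differential S A (fst q) (fst v) \<bullet> fst (X q) + A (fst q) \<bullet> fst (?d X v))) * (snd (Y q) - A (fst q) \<bullet> fst (Y q)))))
      (at q within S \<times> UNIV)"
    unfolding bundle_metric_def
    by (intro has_derivative_add has_derivative_mult has_derivative_inner has_derivative_fst
        has_derivative_connection_form[OF A sX q] has_derivative_connection_form[OF A sY q]
        smooth_map_has_derivative[OF sX q] smooth_map_has_derivative[OF sY q])
  from differential_eq[OF this v]
  show "differential (S \<times> UNIV) (\<lambda>r. bundle_metric A r (X r) (Y r)) q (0, 1) =
      bundle_metric A q (lie_bracket (S \<times> UNIV) (\<lambda>q. (0, 1)) X q) (Y q) +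
      bundle_metric A q (X q) (lie_bracket (S \<times> UNIV) (\<lambda>q. (0, 1)) Y q)"
    unfolding lie_bracket_vertical_field[OF S X q] lie_bracket_vertical_field[OF S Y q]
    by (simp add: bundle_metric_def linear_0[OF lin])
qed

lemma killing_submersion_bundle_metric:
  fixes S :: "'a::euclidean_space set"
  assumes S: "submanifold 2 S" "connected S" "orientation_form 2 S \<omega>" and A: "smooth_map S A"
    and \<Omega>: "orientation_form 3 (S \<times> (UNIV :: real set)) \<Omega>"
  shows "killing_submersion (S \<times> UNIV) (bundle_metric A) S induced_metric fst (\<lambda>q. (0, 1))"
  unfolding killing_submersion_def
proof (intro conjI ballI)
  show "submanifold 3 (S \<times> (UNIV :: real set))"
    using submanifold_Times_UNIV[OF S(1)] by (simp add: numeral_3_eq_3 numeral_2_eq_2)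
  show "\<exists>\<Omega>. orientation_form 3 (S \<times> (UNIV :: real set)) \<Omega>" by (rule exI, rule \<Omega>)
  show "\<exists>\<omega>. orientation_form 2 S \<omega>" by (rule exI, rule S(3))
  show "connected (S \<times> (UNIV :: real set))" using S(2) by (intro connected_Times) auto
  fix q assume q: "q \<in> S \<times> (UNIV :: real set)"
  show "(0, 1) \<in> vertical_space (S \<times> (UNIV :: real set)) fst q" by (simp add: vertical_space_product[OF S(1) q])
  show "bundle_metric A q (0, 1) (0, 1) = 1" by (simp add: bundle_metric_def)
  have "((\<lambda>s. (fst q, snd q + s)) has_vector_derivative (0, 1)) (at s)" for s
    unfolding has_vector_derivative_def by (auto intro!: derivative_eq_intros)
  moreover have "range (\<lambda>s. (fst q, snd q + s)) = {r \<in> S \<times> UNIV. fst r = fst q}"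
  proof (intro equalityI subsetI)
    fix r assume "r \<in> {r \<in> S \<times> (UNIV :: real set). fst r = fst q}"
    then have "r = (fst q, snd q + (snd r - snd q))" by (simp add: prod_eq_iff)
    then show "r \<in> range (\<lambda>s. (fst q, snd q + s))" by blast
  qed (use q in auto)
  ultimately show "\<exists>\<gamma>. integral_curve (S \<times> UNIV) (\<lambda>q. (0, 1)) \<gamma> \<and> \<gamma> 0 = q \<and> range \<gamma> = {r \<in> S \<times> UNIV. fst r = fst q}"
    using q by (intro exI[of _ "\<lambda>s. (fst q, snd q + s)"]) (auto simp: integral_curve_def)
qed (use S \<Omega> in \<open>auto intro: riemannian_metric_bundle_metric[OF A] riemannian_metric_induced_metric
    riemannian_submersion_bundle_metric killing_field_bundle_metric[OF _ A]\<close>)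

section \<open>The bundle curvature\<close>

text \<open>The one-form dual to the vertical field is \<open>dt - A\<close>, so its exterior derivative is the negative of that of
  \<^term>\<open>A\<close>. The terms with derivatives of the two vector fields are absorbed by the Lie bracket.\<close>

lemma bundle_metric_covariant_derivative:
  fixes S :: "'a::euclidean_space set"
  assumes S: "submanifold k S" and A: "smooth_map S A"
    and D: "levi_civita (S \<times> UNIV) (bundle_metric A) D"
    and X: "X \<in> vector_fields (S \<times> UNIV)" and Y: "Y \<in> vector_fields (S \<times> UNIV)" and q: "q \<in> S \<times> UNIV"
  shows "2 * bundle_metric A q (D X (\<lambda>q. (0, 1)) q) (Y q) = - curl S A (fst q) (fst (X q)) (fst (Y q))"
proof -
  let ?M = "S \<times> (UNIV :: real set)"
  have \<eta>: "bundle_metric A q (0, 1) v = snd v - A (fst q) \<bullet> fst v" for q v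
    by (simp add: bundle_metric_def)
  have d: "differential ?M (\<lambda>q. bundle_metric A q (0, 1) (Z q)) q v =
      snd (differential ?M Z q v) - (differential S A (fst q) (fst v) \<bullet> fst (Z q)
        + A (fst q) \<bullet> fst (differential ?M Z q v))"
    if "Z \<in> vector_fields ?M" "v \<in> tangent_space ?M q" for Z v
    unfolding \<eta> by (rule differential_eq[OF has_derivative_connection_form[OF A vector_fieldsD(1)[OF that(1)] q] that(2)])
  show ?thesis
    unfolding killing_field_covariant_derivative[OF submanifold_Times_UNIV[OF S] riemannian_metric_bundle_metric[OF A] D
        killing_field_bundle_metric[OF S A] X Y q]
      d[OF X vector_fieldsD(2)[OF Y q]] d[OF Y vector_fieldsD(2)[OF X q]]
    by (simp add: \<eta> lie_bracket_def curl_def inner_diff_right)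
qed

lemma alternating_form_3:
  assumes "alternating_form 3 V \<Omega>" "subspace V" "x \<in> V" "y \<in> V" "z \<in> V"
  shows "\<Omega> [x + c *\<^sub>R y, y, z] = \<Omega> [x, y, z]" "\<Omega> [x, z, y] = - \<Omega> [x, y, z]" "\<Omega> [x, y, - z] = - \<Omega> [x, y, z]"
proof -
  have L: "length us + length vs + 1 = 3 \<Longrightarrow> set us \<union> set vs \<union> {x, y} \<subseteq> V \<Longrightarrow>
        \<Omega> (us @ (x + y) # vs) = \<Omega> (us @ x # vs) + \<Omega> (us @ y # vs) \<and>
        \<Omega> (us @ (c *\<^sub>R x) # vs) = c * \<Omega> (us @ x # vs)" for us vs x y c
    using assms(1) unfolding alternating_form_def by blast
  have Z: "length vs = 3 \<Longrightarrow> set vs \<subseteq> V \<Longrightarrow> \<not> distinct vs \<Longrightarrow> \<Omega> vs = 0" for vs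
    using assms(1) unfolding alternating_form_def by blast
  have cy: "c *\<^sub>R y \<in> V" and yz: "y + z \<in> V" using assms by (auto intro: subspace_scale subspace_add)
  show "\<Omega> [x + c *\<^sub>R y, y, z] = \<Omega> [x, y, z]"
    using L[of "[]" "[y, z]" x "c *\<^sub>R y"] L[of "[]" "[y, z]" y y c] Z[of "[y, y, z]"] assms cy by simp
  have "\<Omega> [x, y + z, y + z] = 0" "\<Omega> [x, y, y] = 0" "\<Omega> [x, z, z] = 0"
    using Z assms yz by simp_all
  moreover have "\<Omega> [x, y + z, y + z] = \<Omega> [x, y, y + z] + \<Omega> [x, z, y + z]"
    "\<Omega> [x, y, y + z] = \<Omega> [x, y, y] + \<Omega> [x, y, z]" "\<Omega> [x, z, y + z] = \<Omega> [x, z, y] + \<Omega> [x, z, z]"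
    using L[of "[x]" "[y + z]" y z] L[of "[x, y]" "[]" y z] L[of "[x, z]" "[]" y z] assms yz by simp_all
  ultimately show "\<Omega> [x, z, y] = - \<Omega> [x, y, z]" by simp
  show "\<Omega> [x, y, - z] = - \<Omega> [x, y, z]"
    using L[of "[x, y]" "[]" z z "-1"] assms by simp
qed

text \<open>Horizontal vectors have the inner products of their projections, and the lifts of \<open>e\<^sub>1\<close>, \<open>e\<^sub>2\<close> followed by the vertical
  vector form a positive triple iff \<open>e\<^sub>1\<close>, \<open>e\<^sub>2\<close> is positive. In the triple that fixes the sign of the
  cross product, the vertical vector stands in the middle; moving it to the end turns the rotation by \<open>\<pi>/2\<close> into
  its negative.\<close>

lemma cross_product_vertical:
  fixes S :: "'a::euclidean_space set"
  assumes S: "submanifold 2 S" "orientation_form 2 S \<omega>" and \<Omega>: "orientation_form 3 (S \<times> UNIV) \<Omega>"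
    and compat: "\<And>e1 e2. e1 \<in> tangent_space S (fst q) \<Longrightarrow> e2 \<in> tangent_space S (fst q) \<Longrightarrow> \<omega> (fst q) [e1, e2] > 0 \<Longrightarrow>
         \<Omega> q [(e1, A (fst q) \<bullet> e1), (e2, A (fst q) \<bullet> e2), (0, 1)] > 0"
    and q: "q \<in> S \<times> UNIV" and u: "u \<in> tangent_space (S \<times> UNIV) q"
  defines "z \<equiv> - rotation S induced_metric \<omega> (fst q) (fst u)"
  shows "cross_product (S \<times> UNIV) (bundle_metric A) \<Omega> q u (0, 1) = (z, A (fst q) \<bullet> z)"
proof -
  let ?p = "fst q" and ?J = "rotation S induced_metric \<omega> (fst q)" and ?V = "tangent_space (S \<times> (UNIV :: real set)) q"
  let ?T = "tangent_space S ?p" and ?G = "bundle_metric A q"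
  define h where "h = (\<lambda>e. (e, A ?p \<bullet> e))"
  \<comment> \<open>The decomposition of \<^term>\<open>u\<close> into the horizontal lift of \<^term>\<open>e\<close> and \<^term>\<open>s\<close> times the vertical vector.\<close>
  define e s where "e = fst u" "s = snd u - A ?p \<bullet> fst u"
  have p: "?p \<in> S" using q by auto
  note T = subspace_dim_tangent_space(1)[OF S(1) p]
  have V: "?V = ?T \<times> UNIV" by (rule tangent_space_product[OF q])
  have sV: "subspace ?V" unfolding V by (rule subspace_Times[OF T subspace_UNIV])
  have e: "e \<in> ?T" using u V e_s_def by auto
  note J = rotation[OF S p e]
  have ue: "u = h e + s *\<^sub>R (0, 1)" by (simp add: e_s_def h_def prod_eq_iff)
  have alt: "alternating_form 3 ?V (\<Omega> q)" using \<Omega> q unfolding orientation_form_def by blast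
  have hV: "h x \<in> ?V" if "x \<in> ?T" for x using that V h_def by auto
  have \<xi>V: "(0, 1) \<in> ?V" using V subspace_0[OF T] by auto
  have \<Omega>u: "\<Omega> q [u, (0, 1), h x] = - \<Omega> q [h e, h x, (0, 1)]" if "x \<in> ?T" for x
    unfolding ue using alternating_form_3(1)[OF alt sV hV[OF e] \<xi>V hV[OF that], of s]
      alternating_form_3(2)[OF alt sV hV[OF e] hV[OF that] \<xi>V] by simp
  have Guu: "?G u u * ?G (0, 1) (0, 1) - (?G u (0, 1))\<^sup>2 = e \<bullet> e" and Gh: "?G (h x) (0, 1) = 0"
    "?G (h x) u = x \<bullet> e" "?G (h x) (h y) = x \<bullet> y" for x y
    by (simp_all add: bundle_metric_def h_def e_s_def power2_eq_square)
  have z: "z = - ?J e" by (simp add: z_def e_s_def)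
  have "cross_product (S \<times> UNIV) (bundle_metric A) \<Omega> q u (0, 1) = h z"
    unfolding cross_product_def Guu
  proof (rule the_equality, intro conjI impI)
    have zT: "z \<in> ?T" unfolding z by (rule subspace_neg[OF T J(1)])
    show "h z \<in> ?V" by (rule hV[OF zT])
    show "?G (h z) u = 0" "?G (h z) (0, 1) = 0" "?G (h z) (h z) = e \<bullet> e"
      using J by (simp_all add: Gh z)
    assume "h z \<noteq> 0"
    then have "e \<noteq> 0" using J(3) by (auto simp: h_def z zero_prod_def)
    have "\<Omega> q [h e, h (?J e), (0, 1)] > 0"
      using compat[OF e J(1) J(4)[OF \<open>e \<noteq> 0\<close>]] unfolding h_def .
    moreover have "\<Omega> q [u, (0, 1), h z] = - \<Omega> q [u, (0, 1), h (?J e)]"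
      using alternating_form_3(3)[OF alt sV u \<xi>V hV[OF J(1)]] by (simp add: h_def z)
    ultimately show "\<Omega> q [u, (0, 1), h z] > 0" by (simp add: \<Omega>u[OF J(1)])
  next
    fix w assume w: "w \<in> ?V \<and> ?G w u = 0 \<and> ?G w (0, 1) = 0 \<and> ?G w w = e \<bullet> e \<and>
      (w \<noteq> 0 \<longrightarrow> \<Omega> q [u, (0, 1), w] > 0)"
    define x where "x = fst w"
    have x: "x \<in> ?T" using w V unfolding x_def by (metis mem_Times_iff)
    have "w = h x" using w by (simp add: bundle_metric_def h_def x_def prod_eq_iff)
    then have xe: "x \<bullet> e = 0" "x \<bullet> x = e \<bullet> e" and pos: "h x \<noteq> 0 \<Longrightarrow> \<Omega> q [u, (0, 1), h x] > 0"
      using w by (auto simp: Gh)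
    have "?J e = - x"
    proof (rule rotation_eqI[OF S p e])
      show "- x \<in> ?T" by (rule subspace_neg[OF T x])
      assume "e \<noteq> 0"
      then have "x \<noteq> 0" using xe by auto
      then have "h x \<noteq> 0" by (simp add: h_def zero_prod_def)
      from pos[OF this] have "\<not> \<Omega> q [h e, h x, (0, 1)] > 0" by (simp add: \<Omega>u[OF x])
      then have "\<not> \<omega> ?p [e, x] > 0" using compat[OF e x] unfolding h_def by blast
      moreover have "\<omega> ?p [e, x] \<noteq> 0"
      proof -
        have "e \<noteq> x" using xe \<open>e \<noteq> 0\<close> by auto
        moreover have "independent {e, x}"
          by (rule pairwise_orthogonal_independent)
            (use xe \<open>e \<noteq> 0\<close> \<open>x \<noteq> 0\<close> in \<open>auto simp: pairwise_def orthogonal_def inner_commute\<close>)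
        ultimately show ?thesis using S(2) p e x unfolding orientation_form_def by auto
      qed
      moreover have "alternating_form 2 ?T (\<omega> ?p)" using S(2) p unfolding orientation_form_def by blast
      then have "\<omega> ?p [e, - x] = - \<omega> ?p [e, x]"
        using alternating_form_2(4)[of ?T "\<omega> ?p" x e "-1"] x e by simp
      ultimately show "\<omega> ?p [e, - x] > 0" by simp
    qed (use xe in auto)
    then show "w = h z" using \<open>w = h x\<close> by (simp add: z)
  qed
  then show ?thesis by (simp add: h_def)
qed

text \<open>The covariant derivative of the Killing field and the multiple of the cross product have the same inner
  products with all tangent vectors. It is enough to test them against their own difference, extended to a vector field.\<close>

lemma bundle_curvature_bundle_metric:
  fixes S :: "'a::euclidean_space set"
  assumes S: "submanifold 2 S" "orientation_form 2 S \<omega>" and A: "smooth_map S A"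
    and \<Omega>: "orientation_form 3 (S \<times> UNIV) \<Omega>"
    and compat: "\<And>q e1 e2. q \<in> S \<times> UNIV \<Longrightarrow> e1 \<in> tangent_space S (fst q) \<Longrightarrow> e2 \<in> tangent_space S (fst q) \<Longrightarrow>
         \<omega> (fst q) [e1, e2] > 0 \<Longrightarrow> \<Omega> q [(e1, A (fst q) \<bullet> e1), (e2, A (fst q) \<bullet> e2), (0, 1)] > 0"
    and DE: "levi_civita (S \<times> UNIV) (bundle_metric A) DE"
    and curl: "\<And>p u v. p \<in> S \<Longrightarrow> u \<in> tangent_space S p \<Longrightarrow> v \<in> tangent_space S p \<Longrightarrow>
         curl S A p u v = 2 * \<tau> p * (rotation S induced_metric \<omega> p u \<bullet> v)"
  shows "is_bundle_curvature (S \<times> UNIV) (bundle_metric A) \<Omega> DE fst (\<lambda>q. (0, 1)) \<tau>"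
  unfolding is_bundle_curvature_def
proof (intro ballI)
  fix X :: "'a \<times> real \<Rightarrow> 'a \<times> real" and q :: "'a \<times> real"
  assume X: "X \<in> vector_fields (S \<times> UNIV)" and q: "q \<in> S \<times> UNIV"
  let ?p = "fst q" and ?M = "S \<times> (UNIV :: real set)"
  let ?T = "tangent_space S ?p" and ?V = "tangent_space ?M q" and ?G = "bundle_metric A q"
  have p: "?p \<in> S" using q by auto
  note T = subspace_dim_tangent_space(1)[OF S(1) p]
  have V: "?V = ?T \<times> UNIV" by (rule tangent_space_product[OF q])
  have sV: "subspace ?V" unfolding V by (rule subspace_Times[OF T subspace_UNIV])
  have XV: "X q \<in> ?V" by (rule vector_fieldsD(2)[OF X q])
  then have x: "fst (X q) \<in> ?T" using V by auto
  define z where "z = - rotation S induced_metric \<omega> ?p (fst (X q))"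
  define w where "w = DE X (\<lambda>q. (0, 1)) q - \<tau> ?p *\<^sub>R (z, A ?p \<bullet> z)"
  have "DE X (\<lambda>q. (0, 1)) \<in> vector_fields ?M"
    using DE X vertical_field[OF S(1)] unfolding levi_civita_def affine_connection_def by blast
  moreover have "z \<in> ?T" unfolding z_def using subspace_neg[OF T] rotation(1)[OF S p x] by blast
  ultimately have wV: "w \<in> ?V"
    unfolding w_def using vector_fieldsD(2)[OF _ q] V by (intro subspace_diff[OF sV] subspace_scale[OF sV]) auto
  define Y where "Y = (\<lambda>r :: 'a \<times> real. (orth_proj (tangent_space S (fst r)) (fst w), snd w))"
  have Yq: "Y q = w" using wV V orth_proj_ident[OF T, of "fst w"] by (auto simp: Y_def)
  have Y: "Y \<in> vector_fields ?M"
  proof -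
    have P: "(\<lambda>q. orth_proj (tangent_space S q) (fst w)) \<in> vector_fields S"
      by (rule orth_proj_vector_field[OF S(1) smooth_map_const])
    have "smooth_map ?M Y"
      unfolding Y_def
      by (intro smooth_map_Pair smooth_map_const smooth_map_compose[OF smooth_map_fst vector_fieldsD(1)[OF P]]) auto
    moreover have "Y r \<in> tangent_space ?M r" if "r \<in> ?M" for r
      using vector_fieldsD(2)[OF P, of "fst r"] that by (auto simp: Y_def tangent_space_product[OF that])
    ultimately show ?thesis by (simp add: vector_fields_def)
  qed
  have "2 * ?G (DE X (\<lambda>q. (0, 1)) q) w = - curl S A ?p (fst (X q)) (fst w)"
    using bundle_metric_covariant_derivative[OF S(1) A DE X Y q] unfolding Yq .
  also have "\<dots> = 2 * \<tau> ?p * (z \<bullet> fst w)"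
    using curl[OF p x, of "fst w"] wV V by (auto simp: z_def)
  finally have "?G w w = 0"
    by (subst w_def) (simp add: bundle_metric_def inner_diff_left inner_diff_right algebra_simps)
  then have "w = 0" using bundle_metric_pos[of w A q] by force
  then have "DE X (\<lambda>q. (0, 1)) q = \<tau> ?p *\<^sub>R (z, A ?p \<bullet> z)" unfolding w_def by simp
  then show "DE X (\<lambda>q. (0, 1)) q = \<tau> ?p *\<^sub>R cross_product ?M (bundle_metric A) \<Omega> q (X q) (0, 1)"
    using cross_product_vertical[where A = A and q = q, OF S \<Omega> compat[OF q] q XV] unfolding z_def by simp
qed

theorem proposition4p6:
  fixes S :: "(real^'n::finite) set"
    and \<omega> :: "(real^'n) form"
    and a :: "'n \<Rightarrow> real^'n \<Rightarrow> real"
    and \<Omega> :: "((real^'n) \<times> real) form"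
    and DE :: "((real^'n) \<times> real) connection"
    and DS :: "(real^'n) connection"
  assumes surface: "submanifold 2 S" "connected S"
    and oriented: "orientation_form 2 S \<omega>"
    and smooth_coeffs: "\<And>k. smooth_on UNIV (a k)"
    and orientation_E: "orientation_form 3 (S \<times> UNIV) \<Omega>"
    and orientation_compat:
      "\<And>q e1 e2 E1 E2. q \<in> S \<times> UNIV \<Longrightarrow>
         e1 \<in> tangent_space S (fst q) \<Longrightarrow> e2 \<in> tangent_space S (fst q) \<Longrightarrow> \<omega> (fst q) [e1, e2] > 0 \<Longrightarrow>
         is_horizontal_lift (S \<times> UNIV) (ds2 a) fst q e1 E1 \<Longrightarrow>
         is_horizontal_lift (S \<times> UNIV) (ds2 a) fst q e2 E2 \<Longrightarrow>
         \<Omega> q [E1, E2, ddt q] > 0"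
    and nabla_E: "levi_civita (S \<times> UNIV) (ds2 a) DE"
    and nabla_S: "levi_civita S induced_metric DS"
  shows "killing_submersion (S \<times> UNIV) (ds2 a) S induced_metric fst ddt \<and>
    is_bundle_curvature (S \<times> UNIV) (ds2 a) \<Omega> DE fst ddt
      (\<lambda>p. 1/2 * divergence 2 S induced_metric DS
                   (\<lambda>x. rotation S induced_metric \<omega> x (ddt_tangent S a x)) p)"
proof -
  define A where "A = (\<lambda>x. \<chi> k. a k x)"
  have A: "smooth_map S A" unfolding A_def by (rule smooth_map_vec_lambda[OF smooth_coeffs])
  have G: "ds2 a = bundle_metric A" by (simp add: ds2_eq_bundle_metric A_def)
  have \<xi>: "ddt = (\<lambda>q. (0, 1))" by (rule ext) (simp add: ddt_def)
  have compat: "\<Omega> q [(e1, A (fst q) \<bullet> e1), (e2, A (fst q) \<bullet> e2), (0, 1)] > 0"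
    if q: "q \<in> S \<times> UNIV" and e: "e1 \<in> tangent_space S (fst q)" "e2 \<in> tangent_space S (fst q)" "\<omega> (fst q) [e1, e2] > 0"
    for q e1 e2
    using orientation_compat[OF q e is_horizontal_lift_bundle_metric[OF surface(1) q e(1), of A, folded G]
        is_horizontal_lift_bundle_metric[OF surface(1) q e(2), of A, folded G]]
    by (simp add: ddt_def)
  \<comment> \<open>The vertical vector has inner product \<open>- \<langle>A, e\<rangle>\<close> with a vector \<^term>\<open>e\<close> tangent to the slice \<open>t = 0\<close>.\<close>
  have ddt_tangent: "ddt_tangent S a x = orth_proj (tangent_space S x) (- A x)" for x
    unfolding ddt_tangent_def orth_proj_def induced_metric_def G by (simp add: bundle_metric_def ddt_def)
  let ?T = "\<lambda>x. orth_proj (tangent_space S x) (- A x)"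
  let ?W = "\<lambda>x. rotation S induced_metric \<omega> x (?T x)"
  have T: "?T \<in> vector_fields S"
    by (rule orth_proj_vector_field[OF surface(1) smooth_map_minus[OF A]])
  then have W: "?W \<in> vector_fields S"
    by (rule rotation_vector_field[OF surface(1) oriented])
  have WA: "?W q \<bullet> u = A q \<bullet> rotation S induced_metric \<omega> q u" if "q \<in> S" "u \<in> tangent_space S q" for q u
    using rotation(5)[OF surface(1) oriented that(1) vector_fieldsD(2)[OF T that(1)] that(2)]
      orth_proj(2)[OF subspace_dim_tangent_space(1)[OF surface(1) that(1)] rotation(1)[OF surface(1) oriented that], of "- A q"]
    by simp
  have "killing_submersion (S \<times> UNIV) (bundle_metric A) S induced_metric fst (\<lambda>q. (0, 1))"
    by (rule killing_submersion_bundle_metric[OF surface oriented A orientation_E])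
  moreover have "is_bundle_curvature (S \<times> UNIV) (bundle_metric A) \<Omega> DE fst (\<lambda>q. (0, 1))
      (\<lambda>p. 1/2 * divergence 2 S induced_metric DS ?W p)"
    by (rule bundle_curvature_bundle_metric[OF surface(1) oriented A orientation_E compat nabla_E[unfolded G]])
      (simp_all add: curl_eq_divergence[OF surface(1) oriented nabla_S _ A W WA])
  ultimately show ?thesis unfolding G \<xi> ddt_tangent by blast
qed

end
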